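(* For any discrete MAC $(\mathcal{X}_1\times\mathcal{X}_2,p(y|x_1,x_2),\mathcal{Y})$ and any $\mathbf{C}_\mathrm{in}\in\mathbb{R}^2_{\ge0}$, the mapping $$\mathbf{C}_\mathrm{out}\mapsto C_\mathrm{sum,avg}(\mathbf{C}_\mathrm{in},\mathbf{C}_\mathrm{out}),$$ defined on $\mathbb{R}^2_{\ge0}$, is continuous at $\mathbf{C}_\mathrm{out}=\mathbf{0}$.
   Context: A discrete MAC (multiple access channel) is a triple $(\mathcal{X}_1\times\mathcal{X}_2,p(y|x_1,x_2),\mathcal{Y})$ with $\mathcal{X}_1,\mathcal{X}_2,\mathcal{Y}$ finite sets and $p(y|x_1,x_2)$ a conditional probability mass function; it is used memorylessly: $p(y^n|x_1^n,x_2^n)=\prod_{t=1}^n p(y_t|x_{1t},x_{2t})$. For $x\ge 1$, $[x]=\{1,\dots,\lfloor x\rfloor\}$. Let $\mathbf{C}_\mathrm{in}=(C_\mathrm{in}^1,C_\mathrm{in}^2)$ and $\mathbf{C}_\mathrm{out}=(C_\mathrm{out}^1,C_\mathrm{out}^2)$ be in $\mathbb{R}^2_{\ge0}$ (the input and output link capacities of a cooperation facilitator, CF). A $(2^{nR_1},2^{nR_2},n)$-code ($n\ge1$ an integer, $R_1,R_2\ge0$) for the MAC with a $(\mathbf{C}_\mathrm{in},\mathbf{C}_\mathrm{out})$-CF consists of mappings, for $i\in\{1,2\}$, $\varphi_i\colon[2^{nR_i}]\to[2^{nC_\mathrm{in}^i}]$, $\psi_i\colon[2^{nC_\mathrm{in}^1}]\times[2^{nC_\mathrm{in}^2}]\to[2^{nC_\mathrm{out}^i}]$,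 $f_i\colon[2^{nR_i}]\times[2^{nC_\mathrm{out}^i}]\to\mathcal{X}_i^n$, and a decoder $g\colon\mathcal{Y}^n\to[2^{nR_1}]\times[2^{nR_2}]$. For a message pair $(w_1,w_2)$ put $z_i=\psi_i(\varphi_1(w_1),\varphi_2(w_2))$ and $$\lambda_n(w_1,w_2)=\sum_{y^n\colon g(y^n)\ne(w_1,w_2)}p(y^n|f_1(w_1,z_1),f_2(w_2,z_2)).$$ The average error probability is $P^{(n)}_{e,\mathrm{avg}}=2^{-n(R_1+R_2)}\sum_{w_1,w_2}\lambda_n(w_1,w_2)$. A rate pair $(R_1,R_2)$ is achievable (average error) if there is a sequence of $(2^{nR_1},2^{nR_2},n)$-codes with $P^{(n)}_{e,\mathrm{avg}}\to0$ as $n\to\infty$. The average-error capacity region $\mathscr{C}_\mathrm{avg}(\mathbf{C}_\mathrm{in},\mathbf{C}_\mathrm{out})$ is the closure of the set of achievable rate pairs, and $C_\mathrm{sum,avg}(\mathbf{C}_\mathrm{in},\mathbf{C}_\mathrm{out})=\max_{(R_1,R_2)\in\mathscr{C}_\mathrm{avg}(\mathbf{C}_\mathrm{in},\mathbf{C}_\mathrm{out})}(R_1+R_2)$. *)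

theory Defs
  imports "HOL-Probability.Probability"
begin

text \<open>
  A discrete MAC is a function \<open>p :: 'a \<Rightarrow> 'b \<Rightarrow> 'c pmf\<close> over finite input alphabets
  \<open>'a\<close>, \<open>'b\<close> and a finite output alphabet \<open>'c\<close>. Blocks of length \<open>n\<close> over an alphabet
  are the elements of \<open>{1..n} \<rightarrow>\<^sub>E UNIV\<close>.
\<close>

definition index_set :: "real \<Rightarrow> nat set" where
  "index_set x = {1..nat \<lfloor>x\<rfloor>}"

abbreviation blocks :: "nat \<Rightarrow> (nat \<Rightarrow> 'a) set" where
  "blocks n \<equiv> {1..n} \<rightarrow>\<^sub>E UNIV"

definition block_prob ::
    "('a \<Rightarrow> 'b \<Rightarrow> 'c pmf) \<Rightarrow> nat \<Rightarrow> (nat \<Rightarrow> 'a) \<Rightarrow> (nat \<Rightarrow> 'b) \<Rightarrow> (nat \<Rightarrow> 'c) \<Rightarrow> real" where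
  "block_prob p n x1 x2 y = (\<Prod>t = 1..n. pmf (p (x1 t) (x2 t)) (y t))"

text \<open>
  \<open>cf_in i\<close> is what encoder \<open>i\<close> sends to the cooperation facilitator, and \<open>cf_out i\<close> is
  what the facilitator sends back to encoder \<open>i\<close>.
\<close>

record ('a, 'b, 'c) cf_code =
  cf_in1 :: "nat \<Rightarrow> nat"
  cf_in2 :: "nat \<Rightarrow> nat"
  cf_out1 :: "nat \<Rightarrow> nat \<Rightarrow> nat"
  cf_out2 :: "nat \<Rightarrow> nat \<Rightarrow> nat"
  enc1 :: "nat \<Rightarrow> nat \<Rightarrow> (nat \<Rightarrow> 'a)"
  enc2 :: "nat \<Rightarrow> nat \<Rightarrow> (nat \<Rightarrow> 'b)"
  dec :: "(nat \<Rightarrow> 'c) \<Rightarrow> nat \<times> nat"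

definition is_cf_code ::
    "real \<times> real \<Rightarrow> real \<times> real \<Rightarrow> real \<times> real \<Rightarrow> nat \<Rightarrow> ('a, 'b, 'c) cf_code \<Rightarrow> bool" where
  "is_cf_code Cin Cout R n c \<longleftrightarrow>
     (let W1 = index_set (2 powr (real n * fst R)); W2 = index_set (2 powr (real n * snd R));
          U1 = index_set (2 powr (real n * fst Cin)); U2 = index_set (2 powr (real n * snd Cin));
          Z1 = index_set (2 powr (real n * fst Cout)); Z2 = index_set (2 powr (real n * snd Cout))
      in cf_in1 c \<in> W1 \<rightarrow> U1 \<and> cf_in2 c \<in> W2 \<rightarrow> U2 \<and>
         cf_out1 c \<in> U1 \<rightarrow> U2 \<rightarrow> Z1 \<and> cf_out2 c \<in> U1 \<rightarrow> U2 \<rightarrow> Z2 \<and>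
         enc1 c \<in> W1 \<rightarrow> Z1 \<rightarrow> blocks n \<and> enc2 c \<in> W2 \<rightarrow> Z2 \<rightarrow> blocks n \<and>
         dec c \<in> blocks n \<rightarrow> W1 \<times> W2)"

definition error_prob ::
    "('a \<Rightarrow> 'b \<Rightarrow> 'c pmf) \<Rightarrow> nat \<Rightarrow> ('a, 'b, 'c) cf_code \<Rightarrow> nat \<Rightarrow> nat \<Rightarrow> real" where
  "error_prob p n c w1 w2 =
     (let z1 = cf_out1 c (cf_in1 c w1) (cf_in2 c w2);
          z2 = cf_out2 c (cf_in1 c w1) (cf_in2 c w2)
      in \<Sum>y | y \<in> blocks n \<and> dec c y \<noteq> (w1, w2).
           block_prob p n (enc1 c w1 z1) (enc2 c w2 z2) y)"

text \<open>
  The normalization is \<open>2 powr (- n (R1 + R2))\<close>, which differs from the reciprocal of the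
  number of message pairs when \<open>2 powr (n R1)\<close> or \<open>2 powr (n R2)\<close> is not an integer.
\<close>

definition avg_error_prob ::
    "('a \<Rightarrow> 'b \<Rightarrow> 'c pmf) \<Rightarrow> real \<times> real \<Rightarrow> nat \<Rightarrow> ('a, 'b, 'c) cf_code \<Rightarrow> real" where
  "avg_error_prob p R n c =
     2 powr (- (real n * (fst R + snd R))) *
     (\<Sum>w1 \<in> index_set (2 powr (real n * fst R)).
        \<Sum>w2 \<in> index_set (2 powr (real n * snd R)). error_prob p n c w1 w2)"

definition achievable_avg ::
    "('a \<Rightarrow> 'b \<Rightarrow> 'c pmf) \<Rightarrow> real \<times> real \<Rightarrow> real \<times> real \<Rightarrow> real \<times> real \<Rightarrow> bool" where
  "achievable_avg p Cin Cout R \<longleftrightarrow>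
     0 \<le> fst R \<and> 0 \<le> snd R \<and>
     (\<exists>c. (\<forall>n\<ge>1. is_cf_code Cin Cout R n (c n)) \<and>
          (\<lambda>n. avg_error_prob p R n (c n)) \<longlonglongrightarrow> 0)"

definition capacity_region_avg ::
    "('a \<Rightarrow> 'b \<Rightarrow> 'c pmf) \<Rightarrow> real \<times> real \<Rightarrow> real \<times> real \<Rightarrow> (real \<times> real) set" where
  "capacity_region_avg p Cin Cout = closure {R. achievable_avg p Cin Cout R}"

text \<open>
  The maximum exists for finite alphabets: the region is closed, contains \<open>(0, 0)\<close>, and
  \<open>R1 + R2 \<le> log 2 (card (UNIV :: 'c set))\<close> on it.
\<close>

definition sum_capacity_avg ::
    "('a \<Rightarrow> 'b \<Rightarrow> 'c pmf) \<Rightarrow> real \<times> real \<Rightarrow> real \<times> real \<Rightarrow> real" where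
  "sum_capacity_avg p Cin Cout =
     (GREATEST s. \<exists>(R1, R2) \<in> capacity_region_avg p Cin Cout. s = R1 + R2)"

end

theory Submission
  imports Defs
begin

text \<open>
  Given the facilitator output \<open>Z\<close>, which carries few bits, the two messages have conditional mutual
  information at most \<open>H(Z)\<close>. Dueck's wringing argument reveals a small set of positions of the two
  codewords, after which every pair of letters is nearly independent; replacing these joint letter
  laws by products of their marginals costs little, so the sum rate is at most the single-letter
  maximum of \<open>I(X1, X2; Y)\<close> over product inputs plus a term vanishing with the output link
  capacities. Random coding with successive decoding achieves \<open>I(X1, X2; Y)\<close> for every product
  input without any help, and a facilitator can only increase the capacity.
\<close>

section \<open>Entropy and wringing on a finite weighted space\<close>

text \<open>A small total dependence does not limit the dependence of single letters: if every
  letter pair repeats one shared bit, the whole codewords have one bit of mutual information, and so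
  has each of the \<open>n\<close> pairs. Revealing letters removes such repetition. The revealed
  positions must pay for themselves with \<open>e\<close> nats each out of a budget of at most
  \<open>ln (card ZS)\<close>, so there are at most \<open>ln (card ZS) / e\<close> of them, and
  naming their letters costs a fixed multiple of that number. The division by \<open>e\<close>
  dictates the order of the choices: the tolerance fixes \<open>e\<close> and all other constants,
  and only then may the output capacities shrink. The single-letter maximum is never constructed.
  \<open>J\<close> stands for any upper bound of \<open>mac_info\<close>; random coding shows that
  \<open>ln 2\<close> times the sum capacity at zero is such a bound, and the converse with this
  \<open>J\<close> controls the sum capacity nearby. Entropies are in nats and rates in bits, hence
  the factors \<open>ln 2\<close>.\<close>

locale finite_weights =
  fixes \<Omega> :: "'w set" and m :: "'w \<Rightarrow> real"
  assumes fin: "finite \<Omega>" and nn: "\<And>\<omega>. \<omega> \<in> \<Omega> \<Longrightarrow> 0 \<le> m \<omega>" and total: "sum m \<Omega> = 1"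
begin

definition mean :: "('w \<Rightarrow> real) \<Rightarrow> real" where
  "mean f = (\<Sum>\<omega>\<in>\<Omega>. m \<omega> * f \<omega>)"

definition law :: "('w \<Rightarrow> 'x) \<Rightarrow> 'x \<Rightarrow> real" where
  "law X x = (\<Sum>\<omega> | \<omega> \<in> \<Omega> \<and> X \<omega> = x. m \<omega>)"

definition ent :: "('w \<Rightarrow> 'x) \<Rightarrow> real" where
  "ent X = mean (\<lambda>\<omega>. - ln (law X (X \<omega>)))"

text \<open>Conditional mutual information \<open>I(X;Y|U)\<close>. In terms of joint entropies its
  inequalities reduce to \<open>submodular\<close> and re-bracketing of tuples.\<close>

definition cmi :: "('w \<Rightarrow> 'x) \<Rightarrow> ('w \<Rightarrow> 'y) \<Rightarrow> ('w \<Rightarrow> 'z) \<Rightarrow> real" where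
  "cmi X Y U = ent (\<lambda>\<omega>. (X \<omega>, U \<omega>)) + ent (\<lambda>\<omega>. (Y \<omega>, U \<omega>))
     - ent (\<lambda>\<omega>. ((X \<omega>, Y \<omega>), U \<omega>)) - ent U"

text \<open>For \<open>law U u = 0\<close> division by zero makes this the zero function of
  \<open>x\<close>, so its sum is 1 only at values \<open>u\<close> of positive law.\<close>

definition cond_law :: "('w \<Rightarrow> 'x) \<Rightarrow> ('w \<Rightarrow> 'u) \<Rightarrow> 'u \<Rightarrow> 'x \<Rightarrow> real" where
  "cond_law X U u x = law (\<lambda>\<omega>. (X \<omega>, U \<omega>)) (x, u) / law U u"

lemma mean_add: "mean (\<lambda>\<omega>. f \<omega> + g \<omega>) = mean f + mean g"
  by (simp add: mean_def sum.distrib algebra_simps)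

lemma mean_diff: "mean (\<lambda>\<omega>. f \<omega> - g \<omega>) = mean f - mean g"
  by (simp add: mean_def sum_subtractf algebra_simps)

lemma mean_cmult: "mean (\<lambda>\<omega>. c * f \<omega>) = c * mean f"
  by (simp add: mean_def sum_distrib_left algebra_simps)

lemma mean_const [simp]: "mean (\<lambda>\<omega>. c) = c"
  by (simp add: mean_def total flip: sum_distrib_right)

lemma mean_sum: "mean (\<lambda>\<omega>. \<Sum>i\<in>I. f i \<omega>) = (\<Sum>i\<in>I. mean (f i))"
  unfolding mean_def sum_distrib_left by (rule sum.swap)

lemma mean_mono: "(\<And>\<omega>. \<omega> \<in> \<Omega> \<Longrightarrow> 0 < m \<omega> \<Longrightarrow> f \<omega> \<le> g \<omega>) \<Longrightarrow> mean f \<le> mean g"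
  unfolding mean_def
proof (rule sum_mono)
  fix \<omega> assume le: "\<And>\<omega>. \<omega> \<in> \<Omega> \<Longrightarrow> 0 < m \<omega> \<Longrightarrow> f \<omega> \<le> g \<omega>" and \<omega>: "\<omega> \<in> \<Omega>"
  show "m \<omega> * f \<omega> \<le> m \<omega> * g \<omega>"
    using le[OF \<omega>] nn[OF \<omega>] by (cases "m \<omega> = 0") (auto intro: mult_left_mono)
qed

lemma mean_cong: "(\<And>\<omega>. \<omega> \<in> \<Omega> \<Longrightarrow> 0 < m \<omega> \<Longrightarrow> f \<omega> = g \<omega>) \<Longrightarrow> mean f = mean g"
  by (rule order_antisym; rule mean_mono) auto

lemma law_nonneg: "0 \<le> law X x"
  unfolding law_def by (rule sum_nonneg) (use nn in auto)

lemma law_pos: "\<omega> \<in> \<Omega> \<Longrightarrow> 0 < m \<omega> \<Longrightarrow> 0 < law X (X \<omega>)"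
  unfolding law_def using fin nn by (intro sum_pos2[where i = \<omega>]) auto

lemma law_mono:
  "(\<And>\<omega>'. \<omega>' \<in> \<Omega> \<Longrightarrow> Y \<omega>' = y \<Longrightarrow> X \<omega>' = x) \<Longrightarrow> law Y y \<le> law X x"
  unfolding law_def using fin nn by (intro sum_mono2) auto

lemma mean_law: "mean (\<lambda>\<omega>. f (X \<omega>)) = (\<Sum>x\<in>X ` \<Omega>. law X x * f x)"
proof -
  have "mean (\<lambda>\<omega>. f (X \<omega>)) = (\<Sum>x\<in>X ` \<Omega>. \<Sum>\<omega> | \<omega> \<in> \<Omega> \<and> X \<omega> = x. m \<omega> * f (X \<omega>))"
    unfolding mean_def by (rule sum.image_gen[OF fin])
  also have "\<dots> = (\<Sum>x\<in>X ` \<Omega>. law X x * f x)"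
    unfolding law_def by (intro sum.cong refl) (simp add: sum_distrib_right)
  finally show ?thesis .
qed

lemma law_total: "(\<Sum>x\<in>X ` \<Omega>. law X x) = 1"
  using mean_law[of "\<lambda>_. 1" X] by simp

lemma law_marginal:
  assumes "finite A" "V ` \<Omega> \<subseteq> A"
  shows "(\<Sum>v\<in>A. law (\<lambda>\<omega>. (V \<omega>, U \<omega>)) (v, u)) = law U u"
proof -
  have "law U u = (\<Sum>v\<in>A. \<Sum>\<omega> | \<omega> \<in> {\<omega>\<in>\<Omega>. U \<omega> = u} \<and> V \<omega> = v. m \<omega>)"
    unfolding law_def using fin assms by (intro sum.group[symmetric]) auto
  also have "\<dots> = (\<Sum>v\<in>A. law (\<lambda>\<omega>. (V \<omega>, U \<omega>)) (v, u))"
    unfolding law_def by (intro sum.cong refl) auto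
  finally show ?thesis by simp
qed

text \<open>\<open>ln x \<le> x - 1\<close> for the ratio of \<open>law U u * r u v\<close> to the
  joint law: conditional entropy is at most the cross entropy against any conditional subprobability
  \<open>r\<close>. Submodularity, the cardinality bound, decoupling, the bound on the output
  entropy and Fano's inequality are all this lemma with different \<open>r\<close>.\<close>

lemma gibbs:
  fixes U :: "'w \<Rightarrow> 'u" and V :: "'w \<Rightarrow> 'v"
  assumes r: "\<And>u v. 0 \<le> r u v"
    and r_le: "\<And>u. u \<in> U ` \<Omega> \<Longrightarrow> law U u > 0 \<Longrightarrow> (\<Sum>v\<in>V ` \<Omega>. r u v) \<le> 1"
    and r_pos: "\<And>\<omega>. \<omega> \<in> \<Omega> \<Longrightarrow> 0 < m \<omega> \<Longrightarrow> 0 < r (U \<omega>) (V \<omega>)"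
  shows "ent (\<lambda>\<omega>. (V \<omega>, U \<omega>)) - ent U \<le> mean (\<lambda>\<omega>. - ln (r (U \<omega>) (V \<omega>)))"
proof -
  let ?VU = "\<lambda>\<omega>. (V \<omega>, U \<omega>)"
  let ?q = "\<lambda>(v, u). law U u * r u v / law ?VU (v, u)"
  have "ent ?VU - ent U - mean (\<lambda>\<omega>. - ln (r (U \<omega>) (V \<omega>))) = mean (\<lambda>\<omega>. ln (?q (?VU \<omega>)))"
    unfolding ent_def mean_diff[symmetric]
  proof (rule mean_cong)
    fix \<omega> assume \<omega>: "\<omega> \<in> \<Omega>" "0 < m \<omega>"
    show "- ln (law ?VU (?VU \<omega>)) - - ln (law U (U \<omega>)) - - ln (r (U \<omega>) (V \<omega>)) = ln (?q (?VU \<omega>))"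
      using law_pos[OF \<omega>, of ?VU] law_pos[OF \<omega>, of U] r_pos[OF \<omega>] by (simp add: ln_div ln_mult)
  qed
  also have "\<dots> \<le> mean (\<lambda>\<omega>. ?q (?VU \<omega>) - 1)"
  proof (rule mean_mono, rule ln_le_minus_one)
    fix \<omega> assume \<omega>: "\<omega> \<in> \<Omega>" "0 < m \<omega>"
    show "0 < ?q (?VU \<omega>)"
      using law_pos[OF \<omega>, of ?VU] law_pos[OF \<omega>, of U] r_pos[OF \<omega>] by simp
  qed
  also have "\<dots> = mean (\<lambda>\<omega>. ?q (?VU \<omega>)) - 1"
    by (simp add: mean_diff)
  also have "mean (\<lambda>\<omega>. ?q (?VU \<omega>)) = (\<Sum>x\<in>?VU ` \<Omega>. law ?VU x * ?q x)"
    by (rule mean_law)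
  also have "\<dots> \<le> (\<Sum>(v, u)\<in>?VU ` \<Omega>. law U u * r u v)"
    by (rule sum_mono) (auto simp: law_nonneg r)
  also have "\<dots> \<le> (\<Sum>(v, u)\<in>V ` \<Omega> \<times> U ` \<Omega>. law U u * r u v)"
    using fin by (intro sum_mono2) (auto simp: law_nonneg r)
  also have "\<dots> = (\<Sum>u\<in>U ` \<Omega>. law U u * (\<Sum>v\<in>V ` \<Omega>. r u v))"
    unfolding sum.cartesian_product[symmetric] sum_distrib_left by (rule sum.swap)
  also have "\<dots> \<le> (\<Sum>u\<in>U ` \<Omega>. law U u * 1)"
  proof (rule sum_mono)
    fix u assume u: "u \<in> U ` \<Omega>"
    show "law U u * (\<Sum>v\<in>V ` \<Omega>. r u v) \<le> law U u * 1"
      using r_le[OF u] law_nonneg[of U u] by (cases "law U u = 0") (auto intro: mult_left_mono)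
  qed
  also have "\<dots> = 1" by (simp add: law_total)
  finally show ?thesis by simp
qed

lemma ent_mono:
  assumes "\<And>\<omega> \<omega>'. \<omega> \<in> \<Omega> \<Longrightarrow> \<omega>' \<in> \<Omega> \<Longrightarrow> Y \<omega> = Y \<omega>' \<Longrightarrow> X \<omega> = X \<omega>'"
  shows "ent X \<le> ent Y"
  unfolding ent_def
proof (rule mean_mono)
  fix \<omega> assume \<omega>: "\<omega> \<in> \<Omega>" "0 < m \<omega>"
  have "law Y (Y \<omega>) \<le> law X (X \<omega>)" using assms \<omega>(1) by (intro law_mono) blast
  then show "- ln (law X (X \<omega>)) \<le> - ln (law Y (Y \<omega>))"
    using law_pos[OF \<omega>, of Y] by simp
qed

text \<open>Entropy depends only on the partition that a variable induces on
  \<open>\<Omega>\<close>. This serves to re-bracket tuples and to drop components determined by the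
  others.\<close>

lemma ent_eqI:
  assumes "\<And>\<omega> \<omega>'. \<omega> \<in> \<Omega> \<Longrightarrow> \<omega>' \<in> \<Omega> \<Longrightarrow> X \<omega> = X \<omega>' \<longleftrightarrow> Y \<omega> = Y \<omega>'"
  shows "ent X = ent Y"
  using assms by (intro order_antisym ent_mono) blast+

lemma cond_law_nonneg: "0 \<le> cond_law X U u x"
  by (simp add: cond_law_def law_nonneg)

lemma cond_law_pos: "\<omega> \<in> \<Omega> \<Longrightarrow> 0 < m \<omega> \<Longrightarrow> 0 < cond_law X U (U \<omega>) (X \<omega>)"
  unfolding cond_law_def using law_pos[of \<omega> "\<lambda>\<omega>. (X \<omega>, U \<omega>)"] law_pos[of \<omega> U] by simp

lemma sum_cond_law:
  assumes "law U u > 0" "finite A" "X ` \<Omega> \<subseteq> A"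
  shows "(\<Sum>x\<in>A. cond_law X U u x) = 1"
  using assms by (simp add: cond_law_def law_marginal flip: sum_divide_distrib)

lemma mean_ln_cond_law:
  "mean (\<lambda>\<omega>. - ln (cond_law X U (U \<omega>) (X \<omega>))) = ent (\<lambda>\<omega>. (X \<omega>, U \<omega>)) - ent U"
  unfolding ent_def mean_diff[symmetric] cond_law_def
proof (rule mean_cong)
  fix \<omega> assume \<omega>: "\<omega> \<in> \<Omega>" "0 < m \<omega>"
  let ?XU = "\<lambda>\<omega>. (X \<omega>, U \<omega>)"
  show "- ln (law ?XU (X \<omega>, U \<omega>) / law U (U \<omega>)) = - ln (law ?XU (?XU \<omega>)) - - ln (law U (U \<omega>))"
    using law_pos[OF \<omega>, of ?XU] law_pos[OF \<omega>, of U] by (simp add: ln_div)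
qed

text \<open>The reference law in \<open>gibbs\<close> is that of \<open>Y\<close> given
  \<open>Z\<close> alone, which ignores \<open>X\<close>: conditioning on more cannot raise
  entropy.\<close>

lemma submodular:
  "ent (\<lambda>\<omega>. (Y \<omega>, X \<omega>, Z \<omega>)) + ent Z \<le> ent (\<lambda>\<omega>. (X \<omega>, Z \<omega>)) + ent (\<lambda>\<omega>. (Y \<omega>, Z \<omega>))"
proof -
  have "ent (\<lambda>\<omega>. (Y \<omega>, X \<omega>, Z \<omega>)) - ent (\<lambda>\<omega>. (X \<omega>, Z \<omega>))
      \<le> mean (\<lambda>\<omega>. - ln (cond_law Y Z (snd (X \<omega>, Z \<omega>)) (Y \<omega>)))"
  proof (rule gibbs[where r = "\<lambda>xz. cond_law Y Z (snd xz)"])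
    fix u assume "law (\<lambda>\<omega>. (X \<omega>, Z \<omega>)) u > 0"
    also have "law (\<lambda>\<omega>. (X \<omega>, Z \<omega>)) u \<le> law Z (snd u)" by (rule law_mono) auto
    finally show "(\<Sum>v\<in>Y ` \<Omega>. cond_law Y Z (snd u) v) \<le> 1"
      using fin by (simp add: sum_cond_law)
  qed (simp_all add: cond_law_nonneg cond_law_pos)
  then show ?thesis by (simp add: mean_ln_cond_law)
qed

lemma ent_const: "ent (\<lambda>_. c) = 0"
  by (simp add: ent_def law_def total)

lemma ent_le_card:
  assumes "finite A" "X ` \<Omega> \<subseteq> A"
  shows "ent X \<le> ln (card A)"
proof -
  have "A \<noteq> {}" using assms total by force
  then have c: "0 < real (card A)" using assms by (simp add: card_gt_0_iff)
  have "card (X ` \<Omega>) \<le> card A" by (rule card_mono[OF assms])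
  then have "ent (\<lambda>\<omega>. (X \<omega>, ())) - ent (\<lambda>\<omega>. ()) \<le> mean (\<lambda>\<omega>. - ln (1 / card A))"
    using c by (intro gibbs[where r = "\<lambda>_ _. 1 / card A"]) (auto simp: divide_simps)
  moreover have "ent (\<lambda>\<omega>. (X \<omega>, ())) = ent X" by (rule ent_eqI) auto
  ultimately show ?thesis using c by (simp add: ent_const ln_div)
qed

lemma ent_pair_le: "ent (\<lambda>\<omega>. (X \<omega>, Y \<omega>)) \<le> ent X + ent Y"
proof -
  have "ent (\<lambda>\<omega>. (Y \<omega>, X \<omega>, ())) + ent (\<lambda>\<omega>. ())
      \<le> ent (\<lambda>\<omega>. (X \<omega>, ())) + ent (\<lambda>\<omega>. (Y \<omega>, ()))"
    by (rule submodular)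
  moreover have "ent (\<lambda>\<omega>. (Y \<omega>, X \<omega>, ())) = ent (\<lambda>\<omega>. (X \<omega>, Y \<omega>))"
      "ent (\<lambda>\<omega>. (X \<omega>, ())) = ent X" "ent (\<lambda>\<omega>. (Y \<omega>, ())) = ent Y"
    by (rule ent_eqI; auto)+
  ultimately show ?thesis by (simp add: ent_const)
qed

text \<open>Pulling the letters \<open>a\<close>, \<open>b\<close> of \<open>A\<close>, \<open>B\<close> into the conditioning costs at least their own
  mutual information.\<close>

lemma cmi_split:
  assumes a: "\<And>\<omega> \<omega>'. \<omega> \<in> \<Omega> \<Longrightarrow> \<omega>' \<in> \<Omega> \<Longrightarrow> A \<omega> = A \<omega>' \<Longrightarrow> U \<omega> = U \<omega>' \<Longrightarrow> a \<omega> = a \<omega>'"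
    and b: "\<And>\<omega> \<omega>'. \<omega> \<in> \<Omega> \<Longrightarrow> \<omega>' \<in> \<Omega> \<Longrightarrow> B \<omega> = B \<omega>' \<Longrightarrow> U \<omega> = U \<omega>' \<Longrightarrow> b \<omega> = b \<omega>'"
  shows "cmi a b U + cmi A B (\<lambda>\<omega>. ((a \<omega>, b \<omega>), U \<omega>)) \<le> cmi A B U"
proof -
  \<comment> \<open>These two inequalities say \<open>0 \<le> I(A;b|a,U)\<close> and
    \<open>0 \<le> I(B;a|b,U)\<close>. Their sum is the claim once \<open>a\<close> is absorbed into
    \<open>(A, U)\<close> and \<open>b\<close> into \<open>(B, U)\<close>.\<close>
  have "ent (\<lambda>\<omega>. (A \<omega>, b \<omega>, a \<omega>, U \<omega>)) + ent (\<lambda>\<omega>. (a \<omega>, U \<omega>))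
      \<le> ent (\<lambda>\<omega>. (b \<omega>, a \<omega>, U \<omega>)) + ent (\<lambda>\<omega>. (A \<omega>, a \<omega>, U \<omega>))"
    by (rule submodular)
  moreover have "ent (\<lambda>\<omega>. (B \<omega>, a \<omega>, b \<omega>, U \<omega>)) + ent (\<lambda>\<omega>. (b \<omega>, U \<omega>))
      \<le> ent (\<lambda>\<omega>. (a \<omega>, b \<omega>, U \<omega>)) + ent (\<lambda>\<omega>. (B \<omega>, b \<omega>, U \<omega>))"
    by (rule submodular)
  moreover have "ent (\<lambda>\<omega>. (A \<omega>, b \<omega>, a \<omega>, U \<omega>)) = ent (\<lambda>\<omega>. (A \<omega>, (a \<omega>, b \<omega>), U \<omega>))"
    "ent (\<lambda>\<omega>. (B \<omega>, a \<omega>, b \<omega>, U \<omega>)) = ent (\<lambda>\<omega>. (B \<omega>, (a \<omega>, b \<omega>), U \<omega>))"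
    "ent (\<lambda>\<omega>. (b \<omega>, a \<omega>, U \<omega>)) = ent (\<lambda>\<omega>. ((a \<omega>, b \<omega>), U \<omega>))"
    "ent (\<lambda>\<omega>. (a \<omega>, b \<omega>, U \<omega>)) = ent (\<lambda>\<omega>. ((a \<omega>, b \<omega>), U \<omega>))"
    "ent (\<lambda>\<omega>. (A \<omega>, a \<omega>, U \<omega>)) = ent (\<lambda>\<omega>. (A \<omega>, U \<omega>))"
    "ent (\<lambda>\<omega>. (B \<omega>, b \<omega>, U \<omega>)) = ent (\<lambda>\<omega>. (B \<omega>, U \<omega>))"
    "ent (\<lambda>\<omega>. ((A \<omega>, B \<omega>), (a \<omega>, b \<omega>), U \<omega>)) = ent (\<lambda>\<omega>. ((A \<omega>, B \<omega>), U \<omega>))"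
    by (rule ent_eqI; (use a b in blast)?; auto)+
  ultimately show ?thesis by (simp add: cmi_def)
qed

lemma cmi_cong_cond:
  assumes "\<And>\<omega> \<omega>'. \<omega> \<in> \<Omega> \<Longrightarrow> \<omega>' \<in> \<Omega> \<Longrightarrow> U \<omega> = U \<omega>' \<longleftrightarrow> U' \<omega> = U' \<omega>'"
  shows "cmi A B U = cmi A B U'"
proof -
  have "ent (\<lambda>\<omega>. (A \<omega>, U \<omega>)) = ent (\<lambda>\<omega>. (A \<omega>, U' \<omega>))"
    "ent (\<lambda>\<omega>. (B \<omega>, U \<omega>)) = ent (\<lambda>\<omega>. (B \<omega>, U' \<omega>))"
    "ent (\<lambda>\<omega>. ((A \<omega>, B \<omega>), U \<omega>)) = ent (\<lambda>\<omega>. ((A \<omega>, B \<omega>), U' \<omega>))"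
    "ent U = ent U'"
    by (rule ent_eqI; use assms in blast)+
  then show ?thesis by (simp add: cmi_def)
qed

lemma cmi_nonneg: "0 \<le> cmi A B U"
proof -
  have "ent (\<lambda>\<omega>. (A \<omega>, B \<omega>, U \<omega>)) = ent (\<lambda>\<omega>. ((A \<omega>, B \<omega>), U \<omega>))"
    by (rule ent_eqI) auto
  with submodular[of A B U] show ?thesis by (simp add: cmi_def)
qed

text \<open>Minimising the penalised information over all sets of revealed positions makes every
  single letter pair nearly independent: revealing one more pair would otherwise pay off.\<close>

lemma wringing:
  fixes a :: "nat \<Rightarrow> 'w \<Rightarrow> 'x" and b :: "nat \<Rightarrow> 'w \<Rightarrow> 'y" and Z :: "'w \<Rightarrow> 'z"
  assumes T: "finite T" and e: "0 < (e :: real)"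
    and a: "\<And>t \<omega> \<omega>'. \<omega> \<in> \<Omega> \<Longrightarrow> \<omega>' \<in> \<Omega> \<Longrightarrow> A \<omega> = A \<omega>' \<Longrightarrow> Z \<omega> = Z \<omega>' \<Longrightarrow> a t \<omega> = a t \<omega>'"
    and b: "\<And>t \<omega> \<omega>'. \<omega> \<in> \<Omega> \<Longrightarrow> \<omega>' \<in> \<Omega> \<Longrightarrow> B \<omega> = B \<omega>' \<Longrightarrow> Z \<omega> = Z \<omega>' \<Longrightarrow> b t \<omega> = b t \<omega>'"
  defines "U \<equiv> \<lambda>S \<omega>. (\<lambda>t\<in>S. (a t \<omega>, b t \<omega>), Z \<omega>)"
  obtains S where "S \<subseteq> T" "e * card S \<le> cmi A B Z" "\<And>t. t \<in> T \<Longrightarrow> cmi (a t) (b t) (U S) \<le> e"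
proof -
  define \<Phi> where "\<Phi> S = cmi A B (U S) + e * card S" for S
  have Pow: "finite (Pow T)" "Pow T \<noteq> {}" using T by auto
  define S where "S = arg_min_on \<Phi> (Pow T)"
  note S = arg_min_if_finite(1)[OF Pow, of \<Phi>, folded S_def]
    and min = arg_min_least[OF Pow, of _ \<Phi>, folded S_def]
  \<comment> \<open>With nothing revealed only \<open>Z\<close> remains, so comparing the minimum
    with the empty set bounds the penalty \<open>e * card S\<close>.\<close>
  have "cmi A B (U {}) = cmi A B Z"
    by (rule cmi_cong_cond) (auto simp: U_def)
  then have card: "e * card S \<le> cmi A B Z"
    using min[of "{}"] cmi_nonneg[of A B "U S"] by (simp add: \<Phi>_def)
  have letter: "cmi (a t) (b t) (U S) \<le> e" if t: "t \<in> T" for t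
  proof -
    have eq: "cmi A B (U (insert t S)) = cmi A B (\<lambda>\<omega>. ((a t \<omega>, b t \<omega>), U S \<omega>))"
      by (rule cmi_cong_cond) (auto simp: U_def fun_eq_iff restrict_def)
    have "cmi (a t) (b t) (U S) + cmi A B (U (insert t S)) \<le> cmi A B (U S)"
      unfolding eq by (rule cmi_split; rule a b; simp add: U_def)
    moreover have "\<Phi> S \<le> \<Phi> (insert t S)" using S t by (intro min) auto
    \<comment> \<open>Only an inequality, as \<open>t\<close> may already be revealed.\<close>
    moreover have "real (card (insert t S)) \<le> card S + 1"
      using S T by (simp add: card_insert_if finite_subset)
    then have "e * card (insert t S) \<le> e * (card S + 1)"
      using e by (intro mult_left_mono) auto
    then have "e * card (insert t S) \<le> e * card S + e"
      by (simp add: algebra_simps)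
    ultimately show ?thesis by (simp add: \<Phi>_def)
  qed
  show ?thesis
  proof (rule that)
    show "S \<subseteq> T" using S by simp
  qed (fact card, fact letter)
qed

text \<open>A change of measure in the style of Donsker and Varadhan replaces the joint conditional law
  of \<open>a\<close>, \<open>b\<close> by the product of its marginals, at a cost linear in the mutual information.\<close>

lemma decouple:
  fixes a :: "'w \<Rightarrow> 'x::finite" and b :: "'w \<Rightarrow> 'y::finite"
  assumes g: "\<And>u x y. 0 \<le> g u x y" "\<And>u x y. g u x y \<le> L" and s: "0 < s" "s * L \<le> 1"
  shows "mean (\<lambda>\<omega>. g (U \<omega>) (a \<omega>) (b \<omega>)) \<le> cmi a b U / s + s * L\<^sup>2
    + mean (\<lambda>\<omega>. \<Sum>x\<in>UNIV. \<Sum>y\<in>UNIV. cond_law a U (U \<omega>) x * cond_law b U (U \<omega>) y * g (U \<omega>) x y)"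
proof -
  let ?w = "\<lambda>u x y. cond_law a U u x * cond_law b U u y"
  define G where "G u = (\<Sum>x\<in>UNIV. \<Sum>y\<in>UNIV. ?w u x y * g u x y)" for u
  \<comment> \<open>The product of the marginals, exponentially tilted by \<open>s * g\<close>. The
    subtracted \<open>s * G u + (s * L)\<^sup>2\<close> bounds the logarithm of the normalising sum,
    so \<open>r\<close> is a subprobability; in the cross entropy the tilt yields \<open>s\<close>
    times the gap between the true mean of \<open>g\<close> and its mean under the product
    law.\<close>
  define r where "r u v = (case v of (x, y) \<Rightarrow> ?w u x y * exp (s * g u x y - (s * G u + (s * L)\<^sup>2)))"
    for u v
  have "ent (\<lambda>\<omega>. ((a \<omega>, b \<omega>), U \<omega>)) - ent U \<le> mean (\<lambda>\<omega>. - ln (r (U \<omega>) (a \<omega>, b \<omega>)))"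
  proof (rule gibbs[where r = r and V = "\<lambda>\<omega>. (a \<omega>, b \<omega>)"])
    fix u assume u: "law U u > 0"
    have w1: "(\<Sum>x\<in>UNIV. \<Sum>y\<in>UNIV. ?w u x y) = 1"
      by (simp add: sum_cond_law[OF u] flip: sum_distrib_left)
    have "(\<Sum>v\<in>(\<lambda>\<omega>. (a \<omega>, b \<omega>)) ` \<Omega>. r u v) \<le> (\<Sum>v\<in>UNIV. r u v)"
      by (rule sum_mono2) (auto simp: r_def cond_law_nonneg)
    also have "\<dots> = (\<Sum>x\<in>UNIV. \<Sum>y\<in>UNIV. r u (x, y))"
      by (simp add: sum.cartesian_product)
    also have "\<dots> = (\<Sum>x\<in>UNIV. \<Sum>y\<in>UNIV. ?w u x y * exp (s * g u x y)) / exp (s * G u + (s * L)\<^sup>2)"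
      by (simp add: r_def exp_diff sum_divide_distrib)
    also have "\<dots> \<le> (\<Sum>x\<in>UNIV. \<Sum>y\<in>UNIV. ?w u x y * (1 + s * g u x y + (s * L)\<^sup>2))
        / exp (s * G u + (s * L)\<^sup>2)"
    proof (intro divide_right_mono sum_mono mult_left_mono)
      fix x y
      have le: "s * g u x y \<le> s * L" "0 \<le> s * g u x y" using g s by auto
      \<comment> \<open>The quadratic bound on \<open>exp\<close> is for arguments in the unit
        interval, whence the condition \<open>s * L \<le> 1\<close>.\<close>
      then have "exp (s * g u x y) \<le> 1 + s * g u x y + (s * g u x y)\<^sup>2"
        using s(2) by (intro exp_bound) linarith+
      also have "(s * g u x y)\<^sup>2 \<le> (s * L)\<^sup>2" using le by (intro power_mono) auto
      finally show "exp (s * g u x y) \<le> 1 + s * g u x y + (s * L)\<^sup>2" by simp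
    qed (auto simp: cond_law_nonneg)
    also have "(\<Sum>x\<in>UNIV. \<Sum>y\<in>UNIV. ?w u x y * (1 + s * g u x y + (s * L)\<^sup>2))
        = (\<Sum>x\<in>UNIV. \<Sum>y\<in>UNIV. ?w u x y) * (1 + (s * L)\<^sup>2) + s * G u"
      unfolding G_def sum_distrib_left sum_distrib_right sum.distrib[symmetric]
      by (intro sum.cong refl) (simp add: algebra_simps)
    also have "\<dots> = 1 + s * G u + (s * L)\<^sup>2"
      by (simp add: w1)
    also have "(1 + s * G u + (s * L)\<^sup>2) / exp (s * G u + (s * L)\<^sup>2) \<le> 1"
      using exp_ge_add_one_self[of "s * G u + (s * L)\<^sup>2"] by (simp add: add.assoc)
    finally show "(\<Sum>v\<in>(\<lambda>\<omega>. (a \<omega>, b \<omega>)) ` \<Omega>. r u v) \<le> 1" .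
  qed (auto simp: r_def cond_law_nonneg cond_law_pos split: prod.splits)
  also have "\<dots> = mean (\<lambda>\<omega>. (- ln (cond_law a U (U \<omega>) (a \<omega>)) + - ln (cond_law b U (U \<omega>) (b \<omega>)))
      + (s * G (U \<omega>) + (s * L)\<^sup>2) - s * g (U \<omega>) (a \<omega>) (b \<omega>))"
  proof (rule mean_cong)
    fix \<omega> assume \<omega>: "\<omega> \<in> \<Omega>" "0 < m \<omega>"
    show "- ln (r (U \<omega>) (a \<omega>, b \<omega>)) = - ln (cond_law a U (U \<omega>) (a \<omega>)) + - ln (cond_law b U (U \<omega>) (b \<omega>))
      + (s * G (U \<omega>) + (s * L)\<^sup>2) - s * g (U \<omega>) (a \<omega>) (b \<omega>)"
      using cond_law_pos[OF \<omega>, of a U] cond_law_pos[OF \<omega>, of b U] by (simp add: r_def ln_mult)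
  qed
  also have "\<dots> = (ent (\<lambda>\<omega>. (a \<omega>, U \<omega>)) - ent U) + (ent (\<lambda>\<omega>. (b \<omega>, U \<omega>)) - ent U)
      + (s * mean (\<lambda>\<omega>. G (U \<omega>)) + (s * L)\<^sup>2) - s * mean (\<lambda>\<omega>. g (U \<omega>) (a \<omega>) (b \<omega>))"
    by (simp only: mean_diff mean_add mean_cmult mean_const mean_ln_cond_law)
  finally have "s * mean (\<lambda>\<omega>. g (U \<omega>) (a \<omega>) (b \<omega>)) \<le> cmi a b U + s * mean (\<lambda>\<omega>. G (U \<omega>)) + (s * L)\<^sup>2"
    by (simp add: cmi_def)
  then show ?thesis using s by (simp add: G_def field_simps power2_eq_square)
qed

end

section \<open>The converse bound\<close>

text \<open>Inputs are plain real weights rather than pmfs, so that \<open>cond_law\<close>,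
  possibly the zero function, can be inserted.\<close>

definition out_law :: "('a::finite \<Rightarrow> 'b::finite \<Rightarrow> 'c pmf) \<Rightarrow> ('a \<Rightarrow> real) \<Rightarrow> ('b \<Rightarrow> real) \<Rightarrow> 'c \<Rightarrow> real" where
  "out_law p P Q c = (\<Sum>a\<in>UNIV. \<Sum>b\<in>UNIV. P a * Q b * pmf (p a b) c)"

definition rel_ent :: "'c::finite pmf \<Rightarrow> ('c \<Rightarrow> real) \<Rightarrow> real" where
  "rel_ent d q = (\<Sum>c\<in>UNIV. pmf d c * ln (pmf d c / q c))"

text \<open>For probability vectors \<open>P\<close>, \<open>Q\<close> this is
  \<open>I(X1,X2;Y)\<close> under independent inputs, written as the mean divergence of the channel
  law from the output law it induces.\<close>

definition mac_info :: "('a::finite \<Rightarrow> 'b::finite \<Rightarrow> 'c::finite pmf) \<Rightarrow> ('a \<Rightarrow> real) \<Rightarrow> ('b \<Rightarrow> real) \<Rightarrow> real" where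
  "mac_info p P Q = (\<Sum>a\<in>UNIV. \<Sum>b\<in>UNIV. P a * Q b * rel_ent (p a b) (out_law p P Q))"

lemma sum_pmf_finite: "(\<Sum>c\<in>UNIV. pmf (d :: 'c::finite pmf) c) = 1"
  by (rule sum_pmf_eq_1) auto

lemma rel_ent_nonneg:
  assumes "\<And>c. 0 < q c" "(\<Sum>c\<in>UNIV. q c) \<le> 1"
  shows "0 \<le> rel_ent d q"
proof -
  have "0 \<le> (\<Sum>c\<in>UNIV. pmf d c - q c)"
    using assms(2) by (simp add: sum_subtractf sum_pmf_finite)
  also have "\<dots> \<le> rel_ent d q"
    unfolding rel_ent_def
  proof (rule sum_mono)
    fix c
    show "pmf d c - q c \<le> pmf d c * ln (pmf d c / q c)"
    proof (cases "pmf d c = 0")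
      case True
      then show ?thesis using assms(1)[of c] by simp
    next
      case False
      then have pos: "pmf d c > 0" by (simp add: pmf_pos)
      have "ln (q c / pmf d c) \<le> q c / pmf d c - 1"
        by (rule ln_le_minus_one) (use pos assms(1) in simp)
      then have "1 - q c / pmf d c \<le> ln (pmf d c / q c)"
        using pos assms(1)[of c] by (simp add: ln_div)
      then have "pmf d c * (1 - q c / pmf d c) \<le> pmf d c * ln (pmf d c / q c)"
        by (rule mult_left_mono) simp
      then show ?thesis using pos by (simp add: algebra_simps)
    qed
  qed
  finally show ?thesis .
qed

text \<open>A floor under the reference law caps the divergence, since
  \<open>pmf d c \<le> 1\<close>. This provides the bound \<open>L\<close> demanded by
  \<open>decouple\<close>.\<close>

lemma rel_ent_le:
  assumes "0 < k" "\<And>c. k \<le> q c"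
  shows "rel_ent d q \<le> - ln k"
proof -
  have "rel_ent d q \<le> (\<Sum>c\<in>UNIV. pmf d c * (- ln k))"
    unfolding rel_ent_def
  proof (rule sum_mono)
    fix c
    show "pmf d c * ln (pmf d c / q c) \<le> pmf d c * (- ln k)"
    proof (cases "pmf d c = 0")
      case False
      then have pos: "pmf d c > 0" by (simp add: pmf_pos)
      have q: "0 < q c" using assms(1) assms(2)[of c] by linarith
      have "ln (pmf d c) \<le> 0" using pos pmf_le_1[of d c] by simp
      moreover have "ln k \<le> ln (q c)" using assms(1) assms(2)[of c] q by simp
      moreover have "ln (pmf d c / q c) = ln (pmf d c) - ln (q c)" using pos q by (simp add: ln_div)
      ultimately have "ln (pmf d c / q c) \<le> - ln k" by linarith
      then show ?thesis by (rule mult_left_mono) simp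
    qed simp
  qed
  also have "\<dots> = - ln k" unfolding sum_distrib_right[symmetric] by (simp add: sum_pmf_finite)
  finally show ?thesis .
qed

lemma out_law_nonneg:
  assumes "\<And>a. 0 \<le> P a" "\<And>b. 0 \<le> Q b"
  shows "0 \<le> out_law p P Q c"
  unfolding out_law_def using assms by (intro sum_nonneg) simp

lemma out_law_ge:
  assumes "\<And>a. 0 \<le> P a" "\<And>b. 0 \<le> Q b"
  shows "P a * Q b * pmf (p a b) c \<le> out_law p P Q c"
proof -
  have "P a * Q b * pmf (p a b) c \<le> (\<Sum>b\<in>UNIV. P a * Q b * pmf (p a b) c)"
    using assms by (intro member_le_sum) auto
  also have "\<dots> \<le> out_law p P Q c"
    unfolding out_law_def using assms
    by (intro member_le_sum[of a UNIV "\<lambda>a. \<Sum>b\<in>UNIV. P a * Q b * pmf (p a b) c"] sum_nonneg) auto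
  finally show ?thesis .
qed

lemma sum_out_law:
  fixes p :: "'a::finite \<Rightarrow> 'b::finite \<Rightarrow> 'c::finite pmf"
  shows "(\<Sum>c\<in>UNIV. out_law p P Q c) = (\<Sum>a\<in>UNIV. P a) * (\<Sum>b\<in>UNIV. Q b)"
proof -
  have "(\<Sum>c\<in>UNIV. out_law p P Q c) = (\<Sum>a\<in>UNIV. \<Sum>b\<in>UNIV. \<Sum>c\<in>UNIV. P a * Q b * pmf (p a b) c)"
    unfolding out_law_def by (subst sum.swap) (intro sum.cong refl sum.swap)
  also have "\<dots> = (\<Sum>a\<in>UNIV. \<Sum>b\<in>UNIV. P a * Q b)"
    by (simp add: sum_pmf_finite flip: sum_distrib_left)
  finally show ?thesis by (simp add: sum_product)
qed

text \<open>Discarding the floor \<open>k\<close> from the reference law can only increase the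
  divergence, and the factor \<open>1 - \<gamma>\<close> leaves the logarithm as
  \<open>- ln (1 - \<gamma>)\<close>. Terms of positive weight have positive \<open>out_law\<close>,
  so no logarithm of zero is met.\<close>

lemma rel_ent_mixture_le:
  assumes P: "\<And>a. 0 \<le> P a" "sum P UNIV = 1" and Q: "\<And>b. 0 \<le> Q b" "sum Q UNIV = 1"
    and g: "\<gamma> < 1" and k: "0 < k"
  shows "(\<Sum>a\<in>UNIV. \<Sum>b\<in>UNIV. P a * Q b * rel_ent (p a b) (\<lambda>c. (1 - \<gamma>) * out_law p P Q c + k))
    \<le> mac_info p P Q - ln (1 - \<gamma>)"
proof -
  let ?q = "out_law p P Q"
  have "(\<Sum>a\<in>UNIV. \<Sum>b\<in>UNIV. P a * Q b * rel_ent (p a b) (\<lambda>c. (1 - \<gamma>) * ?q c + k))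
    \<le> (\<Sum>a\<in>UNIV. \<Sum>b\<in>UNIV. P a * Q b * (rel_ent (p a b) ?q - ln (1 - \<gamma>)))"
  proof (intro sum_mono)
    fix a b
    show "P a * Q b * rel_ent (p a b) (\<lambda>c. (1 - \<gamma>) * ?q c + k)
      \<le> P a * Q b * (rel_ent (p a b) ?q - ln (1 - \<gamma>))"
    proof (cases "P a * Q b = 0")
      case False
      then have w: "0 < P a * Q b" using P(1)[of a] Q(1)[of b] by (simp add: less_le)
      have "rel_ent (p a b) (\<lambda>c. (1 - \<gamma>) * ?q c + k)
        \<le> (\<Sum>c\<in>UNIV. pmf (p a b) c * (ln (pmf (p a b) c / ?q c) - ln (1 - \<gamma>)))"
        unfolding rel_ent_def
      proof (rule sum_mono)
        fix c
        show "pmf (p a b) c * ln (pmf (p a b) c / ((1 - \<gamma>) * ?q c + k))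
          \<le> pmf (p a b) c * (ln (pmf (p a b) c / ?q c) - ln (1 - \<gamma>))"
        proof (cases "pmf (p a b) c = 0")
          case False
          then have pos: "0 < pmf (p a b) c" by (simp add: pmf_pos)
          have "0 < P a * Q b * pmf (p a b) c" using w pos by simp
          also have "\<dots> \<le> ?q c" by (rule out_law_ge) (use P Q in auto)
          finally have q: "0 < ?q c" .
          have "0 < (1 - \<gamma>) * ?q c" using q g by simp
          then have "ln ((1 - \<gamma>) * ?q c) \<le> ln ((1 - \<gamma>) * ?q c + k)"
            using k by simp
          moreover have "ln ((1 - \<gamma>) * ?q c) = ln (1 - \<gamma>) + ln (?q c)"
            using q g by (simp add: ln_mult)
          moreover have "0 < (1 - \<gamma>) * ?q c + k" using q g k by (simp add: add_pos_pos)
          ultimately have "ln (pmf (p a b) c / ((1 - \<gamma>) * ?q c + k))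
              \<le> ln (pmf (p a b) c / ?q c) - ln (1 - \<gamma>)"
            using pos q by (simp add: ln_div)
          then show ?thesis by (rule mult_left_mono) simp
        qed simp
      qed
      also have "\<dots> = rel_ent (p a b) ?q - ln (1 - \<gamma>)"
        unfolding right_diff_distrib sum_subtractf sum_distrib_right[symmetric]
        by (simp add: rel_ent_def sum_pmf_finite)
      finally show ?thesis using w by (intro mult_left_mono) auto
    qed auto
  qed
  also have "\<dots> = mac_info p P Q - (\<Sum>a\<in>UNIV. \<Sum>b\<in>UNIV. P a * Q b) * ln (1 - \<gamma>)"
    unfolding mac_info_def right_diff_distrib sum_subtractf sum_distrib_right ..
  also have "(\<Sum>a\<in>UNIV. \<Sum>b\<in>UNIV. P a * Q b) = 1"
    using P Q by (simp flip: sum_product)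
  finally show ?thesis by simp
qed

section \<open>The memoryless block channel and the converse for one block\<close>

lemma block_prob_nonneg: "0 \<le> block_prob p n x1 x2 y"
  unfolding block_prob_def by (rule prod_nonneg) simp

lemma sum_blocks_prod:
  fixes f :: "nat \<Rightarrow> 'c::finite \<Rightarrow> real"
  shows "(\<Sum>y\<in>blocks n. \<Prod>t = 1..n. f t (y t)) = (\<Prod>t = 1..n. \<Sum>c\<in>UNIV. f t c)"
  by (rule prod_sum_PiE[symmetric]) auto

lemma finite_blocks: "finite (blocks n :: (nat \<Rightarrow> 'c::finite) set)"
  by (rule finite_PiE) auto

lemma sum_block_prob:
  fixes p :: "'a \<Rightarrow> 'b \<Rightarrow> 'c::finite pmf"
  shows "(\<Sum>y\<in>blocks n. block_prob p n x1 x2 y) = 1"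
  unfolding block_prob_def sum_blocks_prod[of "\<lambda>t. pmf (p (x1 t) (x2 t))"]
  by (simp add: sum_pmf_finite)

lemma sum_block_prob_letter:
  fixes p :: "'a \<Rightarrow> 'b \<Rightarrow> 'c::finite pmf"
  assumes t: "t \<in> {1..n}"
  shows "(\<Sum>y\<in>blocks n. block_prob p n x1 x2 y * h (y t)) = (\<Sum>c\<in>UNIV. pmf (p (x1 t) (x2 t)) c * h c)"
proof -
  let ?f = "\<lambda>s c. pmf (p (x1 s) (x2 s)) c * (if s = t then h c else 1)"
  have "block_prob p n x1 x2 y * h (y t) = (\<Prod>s = 1..n. ?f s (y s))" for y
    using t by (simp add: block_prob_def prod.distrib)
  then have "(\<Sum>y\<in>blocks n. block_prob p n x1 x2 y * h (y t)) = (\<Prod>s = 1..n. \<Sum>c\<in>UNIV. ?f s c)"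
    by (simp only: sum_blocks_prod[of ?f])
  also have "\<dots> = (\<Prod>s = 1..n. if s = t then \<Sum>c\<in>UNIV. pmf (p (x1 t) (x2 t)) c * h c else 1)"
    by (rule prod.cong) (auto simp: sum_pmf_finite)
  finally show ?thesis using t by simp
qed

text \<open>The left side and the first \<open>ln 2\<close> come from Fano's inequality for uniform
  messages. Passing from \<open>H(Y)\<close> to \<open>H(Y|U)\<close>, with \<open>U\<close>
  consisting of \<open>Z\<close> and the revealed letters, costs the two terms in
  \<open>ln (card ZS)\<close>. Per letter, decoupling costs \<open>e / s + s * L\<^sup>2\<close> and
  smoothing the reference law costs \<open>- ln (1 - \<gamma>)\<close>. Of the facilitator only
  \<open>Z\<close>, a function of the message pair, remains.\<close>

lemma converse_bound:
  fixes p :: "'a::finite \<Rightarrow> 'b::finite \<Rightarrow> 'c::finite pmf"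
    and f1 :: "nat \<Rightarrow> 'z \<Rightarrow> nat \<Rightarrow> 'a" and f2 :: "nat \<Rightarrow> 'z \<Rightarrow> nat \<Rightarrow> 'b"
    and Z :: "nat \<times> nat \<Rightarrow> 'z" and W1 W2 :: "nat set" and n :: nat
    and dc :: "(nat \<Rightarrow> 'c) \<Rightarrow> nat \<times> nat"
  assumes W: "finite W1" "W1 \<noteq> {}" "finite W2" "W2 \<noteq> {}"
    and Z: "finite ZS" "Z ` (W1 \<times> W2) \<subseteq> ZS"
    and J: "\<And>P Q. (\<And>a. 0 \<le> P a) \<Longrightarrow> sum P UNIV = 1 \<Longrightarrow> (\<And>b. 0 \<le> Q b) \<Longrightarrow> sum Q UNIV = 1
      \<Longrightarrow> mac_info p P Q \<le> J"
    and \<gamma>: "0 < \<gamma>" "\<gamma> < 1" and e: "0 < e" and s: "0 < s" "s * L \<le> 1"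
    and L_def: "L = - ln (\<gamma> / CARD('c))" and M_def: "M = real (card W1 * card W2)"
    and Pe_def: "Pe = (\<Sum>w\<in>W1 \<times> W2. \<Sum>y | y \<in> blocks n \<and> dc y \<noteq> w.
      block_prob p n (f1 (fst w) (Z w)) (f2 (snd w) (Z w)) y) / (card W1 * card W2)"
  shows "(1 - Pe) * ln M \<le> ln 2 + ln (card ZS) + ln (card ZS) / e * ln (CARD('a \<times> 'b))
    + n * (e / s + s * L\<^sup>2 + J - ln (1 - \<gamma>))"
proof -
  define x1 where "x1 w = f1 (fst w) (Z w)" for w
  define x2 where "x2 w = f2 (snd w) (Z w)" for w
  define \<Omega> where "\<Omega> = (W1 \<times> W2) \<times> (blocks n :: (nat \<Rightarrow> 'c) set)"
  define m where "m = (\<lambda>(w, y). block_prob p n (x1 w) (x2 w) y / M)"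
  have M: "0 < M" using W by (simp add: M_def card_gt_0_iff)
  have sum_\<Omega>: "(\<Sum>\<omega>\<in>\<Omega>. m \<omega> * f \<omega>)
      = (\<Sum>w\<in>W1 \<times> W2. \<Sum>y\<in>blocks n. block_prob p n (x1 w) (x2 w) y * f (w, y)) / M" for f
    unfolding \<Omega>_def m_def
    by (subst sum.cartesian_product') (simp add: sum_divide_distrib)
  have "(\<Sum>w\<in>W1 \<times> W2. 1 :: real) = M" by (simp add: M_def card_cartesian_product)
  then have total: "sum m \<Omega> = 1"
    using sum_\<Omega>[of "\<lambda>_. 1"] M by (simp add: sum_block_prob del: One_nat_def)
  interpret finite_weights \<Omega> m
  proof
    show "finite \<Omega>" unfolding \<Omega>_def using W finite_blocks by auto
    show "sum m \<Omega> = 1" by (fact total)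
  qed (use M in \<open>auto simp: m_def block_prob_nonneg less_imp_le\<close>)
  have mean_eq: "mean f = (\<Sum>w\<in>W1 \<times> W2. \<Sum>y\<in>blocks n. block_prob p n (x1 w) (x2 w) y * f (w, y)) / M" for f
    by (simp add: mean_def sum_\<Omega>)
  \<comment> \<open>Given the messages, letter \<open>t\<close> of the output follows the channel
    law. The test \<open>h\<close> may depend on the outcome only through the message pair and that
    letter.\<close>
  have mean_letter: "mean (\<lambda>\<omega>. h (fst \<omega>) (snd \<omega> t))
      = mean (\<lambda>\<omega>. \<Sum>c\<in>UNIV. pmf (p (x1 (fst \<omega>) t) (x2 (fst \<omega>) t)) c * h (fst \<omega>) c)"
    if "t \<in> {1..n}" for t h
    unfolding mean_eq using that
    by (simp add: sum_block_prob_letter sum_block_prob del: One_nat_def flip: sum_distrib_right)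
  let ?W = "fst :: (nat \<times> nat) \<times> (nat \<Rightarrow> 'c) \<Rightarrow> nat \<times> nat"
  let ?Y = "snd :: (nat \<times> nat) \<times> (nat \<Rightarrow> 'c) \<Rightarrow> nat \<Rightarrow> 'c"
  let ?A = "\<lambda>\<omega>. fst (?W \<omega>)" and ?B = "\<lambda>\<omega>. snd (?W \<omega>)" and ?Z = "\<lambda>\<omega>. Z (?W \<omega>)"
  have \<Omega>D: "fst (?W \<omega>) \<in> W1" "snd (?W \<omega>) \<in> W2" "?W \<omega> \<in> W1 \<times> W2" "?Y \<omega> \<in> blocks n" if "\<omega> \<in> \<Omega>" for \<omega>
    using that by (auto simp: \<Omega>_def)
  have law_W: "law ?W w = 1 / M" if w: "w \<in> W1 \<times> W2" for w
  proof -
    have "{\<omega>. \<omega> \<in> \<Omega> \<and> ?W \<omega> = w} = Pair w ` blocks n"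
      using w by (auto simp: \<Omega>_def)
    then have "law ?W w = (\<Sum>y\<in>blocks n. m (w, y))"
      unfolding law_def by (simp add: sum.reindex inj_on_def)
    then show ?thesis by (simp add: m_def sum_block_prob del: One_nat_def flip: sum_divide_distrib)
  qed
  have ent_W: "ent ?W = ln M"
  proof -
    have "ent ?W = mean (\<lambda>_. ln M)"
      unfolding ent_def by (rule mean_cong) (use M in \<open>simp add: law_W \<Omega>D ln_div\<close>)
    then show ?thesis by simp
  qed
  have ent_Z: "ent ?Z \<le> ln (card ZS)"
    using Z \<Omega>D by (intro ent_le_card) auto
  \<comment> \<open>\<open>Z\<close> is a function of the messages, so
    \<open>H(W1,W2,Z) = ln M\<close>. Then \<open>H(W1,Z) + H(W2,Z) - ln M - H(Z)\<close> is at most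
    \<open>H(Z)\<close>, because \<open>ln M\<close> is the sum of the maximal entropies of the two
    messages.\<close>
  have "cmi ?A ?B ?Z \<le> ln (card ZS)"
  proof -
    have "ent ?A \<le> ln (card W1)" "ent ?B \<le> ln (card W2)"
      using W \<Omega>D by (auto intro!: ent_le_card)
    moreover have "ln M = ln (card W1) + ln (card W2)"
      using W by (simp add: M_def ln_mult card_gt_0_iff)
    moreover have "ent (\<lambda>\<omega>. ((?A \<omega>, ?B \<omega>), ?Z \<omega>)) = ent ?W"
      by (rule ent_eqI) (auto simp: prod_eq_iff)
    ultimately show ?thesis
      using ent_pair_le[of ?A ?Z] ent_pair_le[of ?B ?Z] ent_Z ent_W by (simp add: cmi_def)
  qed
  moreover obtain S where S: "S \<subseteq> {1..n}" "e * card S \<le> cmi ?A ?B ?Z"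
    and letter: "\<And>t. t \<in> {1..n} \<Longrightarrow> cmi (\<lambda>\<omega>. x1 (?W \<omega>) t) (\<lambda>\<omega>. x2 (?W \<omega>) t)
      (\<lambda>\<omega>. (\<lambda>t\<in>S. (x1 (?W \<omega>) t, x2 (?W \<omega>) t), ?Z \<omega>)) \<le> e"
    by (rule wringing[of "{1..n}" e ?A ?Z "\<lambda>t \<omega>. x1 (?W \<omega>) t" ?B "\<lambda>t \<omega>. x2 (?W \<omega>) t"])
       (use e in \<open>auto simp: x1_def x2_def\<close>)
  ultimately have card_S: "card S \<le> ln (card ZS) / e"
    using e by (simp add: field_simps)
  \<comment> \<open>The revealed data as a function of the message pair alone, the form that
    \<open>mean_letter\<close> accepts; \<open>U\<close> is the same variable on
    \<open>\<Omega>\<close>.\<close>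
  define U0 where "U0 w = (\<lambda>t\<in>S. (x1 w t, x2 w t), Z w)" for w
  define U where "U \<omega> = U0 (?W \<omega>)" for \<omega> :: "(nat \<times> nat) \<times> (nat \<Rightarrow> 'c)"
  have ent_U: "ent U \<le> ln (card ZS) / e * ln (CARD('a \<times> 'b)) + ln (card ZS)"
  proof -
    let ?R = "\<lambda>\<omega>. \<lambda>t\<in>S. (x1 (?W \<omega>) t, x2 (?W \<omega>) t)"
    have fS: "finite S" using S(1) finite_subset by blast
    have "ent ?R \<le> ln (card (S \<rightarrow>\<^sub>E (UNIV :: ('a \<times> 'b) set)))"
      using fS by (intro ent_le_card finite_PiE) auto
    also have "\<dots> = card S * ln (CARD('a \<times> 'b))"
      using fS by (simp add: card_PiE ln_realpow)
    also have "\<dots> \<le> ln (card ZS) / e * ln (CARD('a \<times> 'b))"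
    proof (rule mult_right_mono[OF card_S ln_ge_zero])
      have "0 < CARD('a \<times> 'b)" by (rule zero_less_card_finite)
      then show "1 \<le> real (CARD('a \<times> 'b))" by linarith
    qed
    finally show ?thesis using ent_pair_le[of ?R ?Z] ent_Z by (simp add: U_def[abs_def] U0_def)
  qed
  define a where "a t \<omega> = x1 (?W \<omega>) t" for t and \<omega> :: "(nat \<times> nat) \<times> (nat \<Rightarrow> 'c)"
  define b where "b t \<omega> = x2 (?W \<omega>) t" for t and \<omega> :: "(nat \<times> nat) \<times> (nat \<Rightarrow> 'c)"
  have letter_pos: "0 < pmf (p (a t \<omega>) (b t \<omega>)) (?Y \<omega> t)"
    if "\<omega> \<in> \<Omega>" "0 < m \<omega>" "t \<in> {1..n}" for t \<omega>
  proof -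
    have "block_prob p n (x1 (?W \<omega>)) (x2 (?W \<omega>)) (?Y \<omega>) \<noteq> 0"
      using that(2) by (auto simp: m_def split_def)
    then have "pmf (p (a t \<omega>) (b t \<omega>)) (?Y \<omega> t) \<noteq> 0"
      using that(3) by (auto simp: block_prob_def a_def b_def)
    then show ?thesis by (simp add: less_le)
  qed
  \<comment> \<open>The reference output law is smoothed by the uniform law so that relative entropies to it stay
    below \<open>L\<close>.\<close>
  define k where "k = \<gamma> / CARD('c)"
  have k: "0 < k" using \<gamma> by (simp add: k_def)
  define q where "q t u c = (1 - \<gamma>) * out_law p (cond_law (a t) U u) (cond_law (b t) U u) c + k" for t u c
  have q_ge: "k \<le> q t u c" for t u c
    using \<gamma> by (simp add: q_def out_law_nonneg cond_law_nonneg)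
  have q_pos: "0 < q t u c" for t u c using q_ge[of t u c] k by linarith
  \<comment> \<open>At values \<open>u\<close> of law zero \<open>cond_law\<close> vanishes, so the
    sum may be 0. The inequality suffices to make \<open>q\<close> subnormalised for every
    \<open>u\<close>.\<close>
  have cond_le: "0 \<le> sum (cond_law X U u) UNIV \<and> sum (cond_law X U u) UNIV \<le> 1"
    for u and X :: "_ \<Rightarrow> 'x::finite"
    using sum_cond_law[of U u UNIV X] law_nonneg[of U u]
    by (cases "law U u = 0") (auto simp: cond_law_def[of X U u])
  have q_sum: "(\<Sum>c\<in>UNIV. q t u c) \<le> 1" for t u
  proof -
    have "(\<Sum>c\<in>UNIV. q t u c) = (1 - \<gamma>) * (\<Sum>c\<in>UNIV. out_law p (cond_law (a t) U u) (cond_law (b t) U u) c) + \<gamma>"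
      by (simp add: q_def sum.distrib k_def flip: sum_distrib_left)
    also have "\<dots> \<le> (1 - \<gamma>) * 1 + \<gamma>"
      unfolding sum_out_law using \<gamma> cond_le[of "a t" u] cond_le[of "b t" u] by (intro add_right_mono mult_left_mono mult_le_one) auto
    finally show ?thesis by simp
  qed
  \<comment> \<open>The reference law for the block is a product over its letters, so the cross
    entropy splits into single letters even if the letters of \<open>Y\<close> are dependent given
    \<open>U\<close>.\<close>
  have "ent (\<lambda>\<omega>. (?Y \<omega>, U \<omega>)) - ent U \<le> mean (\<lambda>\<omega>. - ln (\<Prod>t = 1..n. q t (U \<omega>) (?Y \<omega> t)))"
  proof (rule gibbs[where V = ?Y and r = "\<lambda>u y. \<Prod>t = 1..n. q t u (y t)"])
    fix u
    have "(\<Sum>y\<in>?Y ` \<Omega>. \<Prod>t = 1..n. q t u (y t)) \<le> (\<Sum>y\<in>blocks n. \<Prod>t = 1..n. q t u (y t))"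
    proof (rule sum_mono2)
      show "?Y ` \<Omega> \<subseteq> blocks n" using \<Omega>D(4) by blast
      show "0 \<le> (\<Prod>t = 1..n. q t u (y t))" for y by (intro prod_nonneg less_imp_le q_pos)
    qed (rule finite_blocks)
    also have "\<dots> = (\<Prod>t = 1..n. \<Sum>c\<in>UNIV. q t u c)" by (rule sum_blocks_prod)
    also have "\<dots> \<le> 1" by (intro prod_le_1 conjI sum_nonneg less_imp_le[OF q_pos] q_sum)
    finally show "(\<Sum>y\<in>?Y ` \<Omega>. \<Prod>t = 1..n. q t u (y t)) \<le> 1" .
  qed (intro prod_nonneg prod_pos less_imp_le[OF q_pos] q_pos)+
  also have "\<dots> = - (\<Sum>t = 1..n. mean (\<lambda>\<omega>. ln (q t (U \<omega>) (?Y \<omega> t))))"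
  proof -
    have "- ln (\<Prod>t = 1..n. q t u (y t)) = (-1) * (\<Sum>t = 1..n. ln (q t u (y t)))" for u y
      by (simp add: ln_prod q_pos less_imp_neq[OF q_pos, symmetric])
    then show ?thesis by (simp only: mean_cmult mean_sum)
  qed
  finally have cond_Y: "ent (\<lambda>\<omega>. (?Y \<omega>, U \<omega>)) - ent U
      \<le> - (\<Sum>t = 1..n. mean (\<lambda>\<omega>. ln (q t (U \<omega>) (?Y \<omega> t))))" .
  have ent_Y: "ent ?Y \<le> ent U - (\<Sum>t = 1..n. mean (\<lambda>\<omega>. ln (q t (U \<omega>) (?Y \<omega> t))))"
  proof -
    have "ent ?Y \<le> ent (\<lambda>\<omega>. (?Y \<omega>, U \<omega>))" by (rule ent_mono) simp
    with cond_Y show ?thesis by linarith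
  qed
  \<comment> \<open>Fano: compare the posterior of the messages with a fair mixture of the decoder's guess and the
    uniform law.\<close>
  have "ent (\<lambda>\<omega>. (?W \<omega>, ?Y \<omega>)) - ent ?Y
      \<le> mean (\<lambda>\<omega>. - ln ((if dc (?Y \<omega>) = ?W \<omega> then 1/2 else 0) + 1 / (2 * M)))"
  proof (rule gibbs[where V = ?W and r = "\<lambda>y w. (if dc y = w then 1/2 else 0) + 1 / (2 * M)"])
    fix y
    have "(\<Sum>w\<in>?W ` \<Omega>. (if dc y = w then 1/2 else 0) + 1 / (2 * M))
        \<le> (\<Sum>w\<in>W1 \<times> W2. (if dc y = w then 1/2 else 0) + 1 / (2 * M))"
      using W M \<Omega>D(3) by (intro sum_mono2) (auto simp: image_subset_iff)
    also have "\<dots> \<le> 1" using W M by (simp add: sum.distrib M_def card_cartesian_product)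
    finally show "(\<Sum>w\<in>?W ` \<Omega>. (if dc y = w then 1/2 else 0) + 1 / (2 * M)) \<le> 1" .
  qed (use M in \<open>auto intro: add_nonneg_pos\<close>)
  also have "\<dots> \<le> mean (\<lambda>\<omega>. ln 2 + (if dc (?Y \<omega>) \<noteq> ?W \<omega> then 1 else 0) * ln M)"
  proof (rule mean_mono)
    fix \<omega>
    have "ln (1 / 2) \<le> ln (1 / 2 + 1 / (2 * M))" using M by (subst ln_le_cancel_iff) (auto intro: add_pos_pos)
    then show "- ln ((if dc (?Y \<omega>) = ?W \<omega> then 1 / 2 else 0) + 1 / (2 * M))
        \<le> ln 2 + (if dc (?Y \<omega>) \<noteq> ?W \<omega> then 1 else 0) * ln M"
      using M by (simp add: ln_div ln_mult)
  qed
  also have "\<dots> = ln 2 + Pe * ln M"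
  proof -
    have "mean (\<lambda>\<omega>. if dc (?Y \<omega>) \<noteq> ?W \<omega> then 1 else 0) = Pe"
      unfolding mean_eq Pe_def M_def x1_def[symmetric] x2_def[symmetric]
      unfolding sum.inter_filter[OF finite_blocks]
      by (intro arg_cong2[where f = "(/)"] sum.cong refl) simp
    then show ?thesis by (simp add: mean_add mean_cmult[of "ln M"] mult.commute[of _ "ln M"])
  qed
  finally have fano: "ent (\<lambda>\<omega>. (?W \<omega>, ?Y \<omega>)) \<le> ent ?Y + ln 2 + Pe * ln M" by simp
  \<comment> \<open>A point of \<open>\<Omega>\<close> is the pair
    \<open>(?W \<omega>, ?Y \<omega>)\<close> itself, so its law is \<open>m\<close>, and the
    entropy is \<open>ln M\<close> plus the conditional entropy of a memoryless channel
    output.\<close>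
  have joint: "ent (\<lambda>\<omega>. (?W \<omega>, ?Y \<omega>))
      = ln M - (\<Sum>t = 1..n. mean (\<lambda>\<omega>. ln (pmf (p (a t \<omega>) (b t \<omega>)) (?Y \<omega> t))))"
  proof -
    have "ent (\<lambda>\<omega>. (?W \<omega>, ?Y \<omega>)) = mean (\<lambda>\<omega>. ln M - (\<Sum>t = 1..n. ln (pmf (p (a t \<omega>) (b t \<omega>)) (?Y \<omega> t))))"
      unfolding ent_def
    proof (rule mean_cong)
      fix \<omega> assume \<omega>: "\<omega> \<in> \<Omega>" "0 < m \<omega>"
      have "{\<omega>'. \<omega>' \<in> \<Omega> \<and> (?W \<omega>', ?Y \<omega>') = (?W \<omega>, ?Y \<omega>)} = {\<omega>}" using \<omega> by auto
      then have "law (\<lambda>\<omega>. (?W \<omega>, ?Y \<omega>)) (?W \<omega>, ?Y \<omega>) = m \<omega>" by (simp add: law_def)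
      also have "ln (m \<omega>) = (\<Sum>t = 1..n. ln (pmf (p (a t \<omega>) (b t \<omega>)) (?Y \<omega> t))) - ln M"
      proof -
        have "m \<omega> = (\<Prod>t = 1..n. pmf (p (a t \<omega>) (b t \<omega>)) (?Y \<omega> t)) / M"
          by (simp add: m_def split_def block_prob_def a_def b_def)
        moreover have "ln (\<Prod>t = 1..n. pmf (p (a t \<omega>) (b t \<omega>)) (?Y \<omega> t))
            = (\<Sum>t = 1..n. ln (pmf (p (a t \<omega>) (b t \<omega>)) (?Y \<omega> t)))"
          by (intro ln_prod less_imp_neq[OF letter_pos[OF \<omega>], symmetric]) auto
        moreover have "0 < (\<Prod>t = 1..n. pmf (p (a t \<omega>) (b t \<omega>)) (?Y \<omega> t))"
          by (intro prod_pos letter_pos[OF \<omega>])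
        ultimately show ?thesis using M by (metis ln_div less_irrefl)
      qed
      finally show "- ln (law (\<lambda>\<omega>. (?W \<omega>, ?Y \<omega>)) (?W \<omega>, ?Y \<omega>))
          = ln M - (\<Sum>t = 1..n. ln (pmf (p (a t \<omega>) (b t \<omega>)) (?Y \<omega> t)))" by simp
    qed
    then show ?thesis by (simp only: mean_diff mean_const mean_sum)
  qed
  \<comment> \<open>Averaging over the output letter turns the log ratio into a divergence that
    depends on \<open>U\<close> and the two input letters. \<open>decouple\<close> replaces their
    conditional law by a product, and for each value of \<open>U\<close> the product case is bounded
    through \<open>J\<close>.\<close>
  have rate: "mean (\<lambda>\<omega>. ln (pmf (p (a t \<omega>) (b t \<omega>)) (?Y \<omega> t))) - mean (\<lambda>\<omega>. ln (q t (U \<omega>) (?Y \<omega> t)))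
      \<le> e / s + s * L\<^sup>2 + J - ln (1 - \<gamma>)" if t: "t \<in> {1..n}" for t
  proof -
    have "mean (\<lambda>\<omega>. ln (pmf (p (a t \<omega>) (b t \<omega>)) (?Y \<omega> t))) - mean (\<lambda>\<omega>. ln (q t (U \<omega>) (?Y \<omega> t)))
        = mean (\<lambda>\<omega>. rel_ent (p (a t \<omega>) (b t \<omega>)) (q t (U \<omega>)))"
      proof -
      have "mean (\<lambda>\<omega>. ln (pmf (p (a t \<omega>) (b t \<omega>)) (?Y \<omega> t))) - mean (\<lambda>\<omega>. ln (q t (U \<omega>) (?Y \<omega> t)))
        = mean (\<lambda>\<omega>. ln (pmf (p (a t \<omega>) (b t \<omega>)) (?Y \<omega> t) / q t (U \<omega>) (?Y \<omega> t)))"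
        unfolding mean_diff[symmetric]
      proof (rule mean_cong)
        fix \<omega> assume "\<omega> \<in> \<Omega>" "0 < m \<omega>"
        from letter_pos[OF this t] q_pos[of t "U \<omega>" "?Y \<omega> t"]
        show "ln (pmf (p (a t \<omega>) (b t \<omega>)) (?Y \<omega> t)) - ln (q t (U \<omega>) (?Y \<omega> t))
          = ln (pmf (p (a t \<omega>) (b t \<omega>)) (?Y \<omega> t) / q t (U \<omega>) (?Y \<omega> t))"
          by (simp add: ln_div)
      qed
      then show ?thesis
        using mean_letter[OF t, of "\<lambda>w c. ln (pmf (p (x1 w t) (x2 w t)) c / q t (U0 w) c)"]
        by (simp add: a_def b_def U_def rel_ent_def)
    qed
    also have "\<dots> \<le> cmi (a t) (b t) U / s + s * L\<^sup>2
      + mean (\<lambda>\<omega>. \<Sum>x\<in>UNIV. \<Sum>y\<in>UNIV. cond_law (a t) U (U \<omega>) x * cond_law (b t) U (U \<omega>) y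
          * rel_ent (p x y) (q t (U \<omega>)))"
    proof (rule decouple[where g = "\<lambda>u x y. rel_ent (p x y) (q t u)"])
      show "rel_ent (p x y) (q t u) \<le> L" for u x y
        using rel_ent_le[OF k q_ge] by (simp add: L_def k_def)
    qed (use s q_pos q_sum in \<open>auto intro: rel_ent_nonneg\<close>)
    also have "\<dots> \<le> e / s + s * L\<^sup>2 + mean (\<lambda>\<omega>. J - ln (1 - \<gamma>))"
      proof (intro add_mono mean_mono order_refl)
      show "cmi (a t) (b t) U / s \<le> e / s"
        using letter[OF t] s by (intro divide_right_mono) (simp_all add: a_def[abs_def] b_def[abs_def] U_def[abs_def] U0_def)
      fix \<omega> assume \<omega>: "\<omega> \<in> \<Omega>" "0 < m \<omega>"
      have one: "sum (cond_law (a t) U (U \<omega>)) UNIV = 1" "sum (cond_law (b t) U (U \<omega>)) UNIV = 1"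
        by (rule sum_cond_law[OF law_pos[OF \<omega>]]; simp)+
      have "(\<Sum>x\<in>UNIV. \<Sum>y\<in>UNIV. cond_law (a t) U (U \<omega>) x * cond_law (b t) U (U \<omega>) y
          * rel_ent (p x y) (q t (U \<omega>)))
        \<le> mac_info p (cond_law (a t) U (U \<omega>)) (cond_law (b t) U (U \<omega>)) - ln (1 - \<gamma>)"
        unfolding q_def[abs_def] by (intro rel_ent_mixture_le \<gamma>(2) k one cond_law_nonneg)
      also have "\<dots> \<le> J - ln (1 - \<gamma>)"
        by (intro diff_right_mono J one cond_law_nonneg)
      finally show "(\<Sum>x\<in>UNIV. \<Sum>y\<in>UNIV. cond_law (a t) U (U \<omega>) x * cond_law (b t) U (U \<omega>) y
          * rel_ent (p x y) (q t (U \<omega>))) \<le> J - ln (1 - \<gamma>)" .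
    qed
    finally show ?thesis by simp
  qed
  have "ln M + (\<Sum>t = 1..n. mean (\<lambda>\<omega>. ln (q t (U \<omega>) (?Y \<omega> t))))
      - (\<Sum>t = 1..n. mean (\<lambda>\<omega>. ln (pmf (p (a t \<omega>) (b t \<omega>)) (?Y \<omega> t)))) \<le> ent U + ln 2 + Pe * ln M"
    using fano joint ent_Y by linarith
  moreover have "(\<Sum>t = 1..n. mean (\<lambda>\<omega>. ln (pmf (p (a t \<omega>) (b t \<omega>)) (?Y \<omega> t))))
      - (\<Sum>t = 1..n. mean (\<lambda>\<omega>. ln (q t (U \<omega>) (?Y \<omega> t)))) \<le> n * (e / s + s * L\<^sup>2 + J - ln (1 - \<gamma>))"
    unfolding sum_subtractf[symmetric]
    using sum_bounded_above[of "{1..n}", OF rate] by simp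
  ultimately show ?thesis using ent_U by (simp add: algebra_simps)
qed

section \<open>Random coding\<close>

lemma prob_bind_pmf:
  "measure_pmf.prob (bind_pmf M N) X = measure_pmf.expectation M (\<lambda>x. measure_pmf.prob (N x) X)"
proof -
  have "ennreal (measure_pmf.prob (bind_pmf M N) X) = (\<integral>\<^sup>+x. ennreal (measure_pmf.prob (N x) X) \<partial>M)"
    by (simp add: measure_pmf.emeasure_eq_measure[symmetric])
  also have "\<dots> = ennreal (measure_pmf.expectation M (\<lambda>x. measure_pmf.prob (N x) X))"
    by (intro nn_integral_eq_integral measure_pmf.integrable_const_bound[where B = 1]) auto
  finally show ?thesis by (simp add: integral_nonneg)
qed

text \<open>Change of measure: on \<open>S\<close> the law \<open>d\<close> is at most
  \<open>a\<close> times \<open>d'\<close>, whose total mass is 1. It bounds the probability that a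
  wrong codeword passes a threshold test.\<close>

lemma prob_le_of_pmf_le:
  assumes fin: "finite (set_pmf d)" and a: "0 \<le> a"
    and le: "\<And>y. y \<in> S \<Longrightarrow> pmf d y \<le> a * pmf d' y"
  shows "measure_pmf.prob d S \<le> a"
proof -
  have fin': "finite (S \<inter> set_pmf d)" using fin by simp
  have "measure_pmf.prob d S = (\<Sum>y\<in>S \<inter> set_pmf d. pmf d y)"
    using measure_measure_pmf_finite[OF fin', of d] measure_Int_set_pmf[of d S] by simp
  also have "\<dots> \<le> (\<Sum>y\<in>S \<inter> set_pmf d. a * pmf d' y)"
    using le by (intro sum_mono) auto
  also have "\<dots> = a * measure_pmf.prob d' (S \<inter> set_pmf d)"
    using measure_measure_pmf_finite[OF fin'] by (simp add: sum_distrib_left)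
  also have "\<dots> \<le> a * 1" by (intro mult_left_mono a) simp
  finally show ?thesis by simp
qed

text \<open>Derandomisation: some codebook is at least as good as the random one is on
  average.\<close>

lemma exists_le_expectation:
  fixes f :: "'a \<Rightarrow> real"
  assumes "finite (set_pmf M)"
  shows "\<exists>x\<in>set_pmf M. f x \<le> measure_pmf.expectation M f"
proof (rule ccontr)
  assume "\<not> ?thesis"
  then have "AE x in M. measure_pmf.expectation M f < f x"
    by (auto simp: AE_measure_pmf_iff)
  then have "measure_pmf.expectation M f < measure_pmf.expectation M f"
    using assms by (intro measure_pmf.expectation_greater integrable_measure_pmf_finite)
  then show False by simp
qed

lemma map_pmf_pair_components:
  "map_pmf (\<lambda>c. (f (fst c), g (snd c))) (pair_pmf A B) = pair_pmf (map_pmf f A) (map_pmf g B)"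
  unfolding map_pair[symmetric] by (simp add: split_def)

text \<open>Two different codewords are independent; the error analysis uses no more of the joint
  law of one codebook.\<close>

lemma Pi_pmf_two_components:
  assumes "finite A" "i \<in> A" "j \<in> A" "i \<noteq> j"
  shows "map_pmf (\<lambda>f. (f i, f j)) (Pi_pmf A d Q) = pair_pmf (Q i) (Q j)"
proof -
  have A: "A = insert i (A - {i})" using assms by auto
  have "map_pmf (\<lambda>f. (f i, f j)) (Pi_pmf A d Q)
      = map_pmf (\<lambda>(x, f). (x, f j)) (pair_pmf (Q i) (Pi_pmf (A - {i}) d Q))"
    using assms by (subst A, subst Pi_pmf_insert) (auto simp: pmf.map_comp o_def split_def)
  also have "\<dots> = pair_pmf (Q i) (map_pmf (\<lambda>f. f j) (Pi_pmf (A - {i}) d Q))"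
    by (simp add: pair_map_pmf2 apsnd_def map_prod_def split_def)
  also have "\<dots> = pair_pmf (Q i) (Q j)"
    using assms by (subst Pi_pmf_component) auto
  finally show ?thesis .
qed

text \<open>Successive decoding: the test \<open>A\<close> rejects a wrong second message treating the first
  codeword as noise, and \<open>B\<close> then rejects a wrong first message given the second codeword.\<close>

lemma random_coding:
  fixes P :: "'x pmf" and Q :: "'z pmf" and K :: "'x \<Rightarrow> 'z \<Rightarrow> 'y pmf" and W1 W2 :: "nat set"
    and \<alpha> \<beta> :: real
  defines "q2 \<equiv> \<lambda>z. bind_pmf P (\<lambda>x. K x z)"
  defines "q \<equiv> bind_pmf Q q2"
  assumes fin: "finite (set_pmf P)" "finite (set_pmf Q)" "\<And>x z. finite (set_pmf (K x z))"
    and W: "finite W1" "W1 \<noteq> {}" "finite W2" "W2 \<noteq> {}"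
    and A: "\<And>z y. A z y \<Longrightarrow> pmf q y \<le> \<alpha> * pmf (q2 z) y"
    and B: "\<And>x z y. B x z y \<Longrightarrow> pmf (q2 z) y \<le> \<beta> * pmf (K x z) y"
    and \<alpha>\<beta>: "0 \<le> \<alpha>" "0 \<le> \<beta>"
  obtains c1 c2 g where "\<And>w. w \<in> W1 \<Longrightarrow> c1 w \<in> set_pmf P" "\<And>w. w \<in> W2 \<Longrightarrow> c2 w \<in> set_pmf Q"
    "\<And>y. g y \<in> W1 \<times> W2"
    "(\<Sum>w\<in>W1 \<times> W2. measure_pmf.prob (K (c1 (fst w)) (c2 (snd w))) {y. g y \<noteq> w})
      \<le> card W1 * card W2 * (measure_pmf.expectation (pair_pmf P Q)
            (\<lambda>(x, z). measure_pmf.prob (K x z) {y. \<not> (A z y \<and> B x z y)})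
          + (card W2 - 1) * \<alpha> + (card W1 - 1) * \<beta>)"
proof -
  define good where "good = (\<lambda>(c1, c2) y (w :: nat \<times> nat). A (c2 (snd w)) y \<and> B (c1 (fst w)) (c2 (snd w)) y)"
  define g where "g c y = (if \<exists>w\<in>W1 \<times> W2. good c y w then SOME w. w \<in> W1 \<times> W2 \<and> good c y w
    else SOME w. w \<in> W1 \<times> W2)" for c y
  define Kc where "Kc = (\<lambda>(c1, c2) (w :: nat \<times> nat). K (c1 (fst w)) (c2 (snd w)))"
  define C1 where "C1 = Pi_pmf W1 undefined (\<lambda>_. P)"
  define C2 where "C2 = Pi_pmf W2 undefined (\<lambda>_. Q)"
  define C where "C = pair_pmf C1 C2"
  have g_mem: "g c y \<in> W1 \<times> W2" for c y
  proof (cases "\<exists>w. w \<in> W1 \<times> W2 \<and> good c y w")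
    case True
    then show ?thesis using someI_ex[OF True] unfolding g_def by auto
  next
    case False
    have "\<exists>w. w \<in> W1 \<times> W2" using W by auto
    from someI_ex[OF this] show ?thesis using False unfolding g_def by auto
  qed
  have fin_q: "finite (set_pmf q)" "finite (set_pmf (q2 z))" for z
    using fin by (auto simp: q_def q2_def)
  have fin_C: "finite (set_pmf C)"
    using W fin by (auto simp: C_def C1_def C2_def set_Pi_pmf o_def)
  have int: "integrable (measure_pmf C) f" for f :: "_ \<Rightarrow> real"
    by (rule integrable_measure_pmf_finite[OF fin_C])
  let ?\<delta> = "measure_pmf.expectation (pair_pmf P Q)
            (\<lambda>(x, z). measure_pmf.prob (K x z) {y. \<not> (A z y \<and> B x z y)})"
  let ?E = "measure_pmf.expectation C"
  have err: "?E (\<lambda>c. measure_pmf.prob (Kc c w) {y. g c y \<noteq> w})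
      \<le> ?\<delta> + (card W2 - 1) * \<alpha> + (card W1 - 1) * \<beta>" if w: "w \<in> W1 \<times> W2" for w
  proof -
    obtain w1 w2 where w_eq: "w = (w1, w2)" and w12: "w1 \<in> W1" "w2 \<in> W2" using w by auto
    have "measure_pmf.prob (Kc c w) {y. g c y \<noteq> w} \<le> measure_pmf.prob (Kc c w) {y. \<not> good c y w}
        + (\<Sum>v\<in>W2 - {w2}. measure_pmf.prob (Kc c w) {y. A (snd c v) y})
        + (\<Sum>v\<in>W1 - {w1}. measure_pmf.prob (Kc c w) {y. B (fst c v) (snd c w2) y})" for c
    proof -
      \<comment> \<open>Suppose the sent pair passes and no wrong second codeword passes
        \<open>A\<close>. Then every candidate has second component \<open>w2\<close>, and
        \<open>B\<close> has to reject wrong first messages only together with the true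
        \<open>w2\<close>. The number of events thus grows with the sum of the two message counts,
        not with their product.\<close>
      have sub: "{y. g c y \<noteq> w} \<subseteq> {y. \<not> good c y w} \<union> (\<Union>v\<in>W2 - {w2}. {y. A (snd c v) y})
          \<union> (\<Union>v\<in>W1 - {w1}. {y. B (fst c v) (snd c w2) y})"
      proof (rule subsetI, rule ccontr)
        fix y assume ne: "y \<in> {y. g c y \<noteq> w}" and "\<not> y \<in> {y. \<not> good c y w}
          \<union> (\<Union>v\<in>W2 - {w2}. {y. A (snd c v) y}) \<union> (\<Union>v\<in>W1 - {w1}. {y. B (fst c v) (snd c w2) y})"
        then have *: "good c y w" "\<And>v. v \<in> W2 \<Longrightarrow> v \<noteq> w2 \<Longrightarrow> \<not> A (snd c v) y"
          "\<And>v. v \<in> W1 \<Longrightarrow> v \<noteq> w1 \<Longrightarrow> \<not> B (fst c v) (snd c w2) y" by auto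
        then have ex: "\<exists>w. w \<in> W1 \<times> W2 \<and> good c y w" using w by blast
        then have "g c y = (SOME w. w \<in> W1 \<times> W2 \<and> good c y w)" unfolding g_def by auto
        then have "g c y \<in> W1 \<times> W2 \<and> good c y (g c y)" using someI_ex[OF ex] by simp
        then have "g c y = w"
          using * by (cases "g c y") (auto simp: good_def w_eq split_def)
        then show False using ne by simp
      qed
      have "measure_pmf.prob (Kc c w) {y. g c y \<noteq> w} \<le> measure_pmf.prob (Kc c w) {y. \<not> good c y w}
        + measure_pmf.prob (Kc c w) (\<Union>v\<in>W2 - {w2}. {y. A (snd c v) y})
        + measure_pmf.prob (Kc c w) (\<Union>v\<in>W1 - {w1}. {y. B (fst c v) (snd c w2) y})"
        by (rule order_trans[OF measure_pmf.finite_measure_mono[OF sub]], simp,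
            rule order_trans[OF measure_Un_le], simp, simp)
           (simp add: measure_Un_le)
      also have "\<dots> \<le> measure_pmf.prob (Kc c w) {y. \<not> good c y w}
        + (\<Sum>v\<in>W2 - {w2}. measure_pmf.prob (Kc c w) {y. A (snd c v) y})
        + (\<Sum>v\<in>W1 - {w1}. measure_pmf.prob (Kc c w) {y. B (fst c v) (snd c w2) y})"
        using W by (intro add_mono order_refl measure_UNION_le) auto
      finally show ?thesis .
    qed
    then have "?E (\<lambda>c. measure_pmf.prob (Kc c w) {y. g c y \<noteq> w})
        \<le> ?E (\<lambda>c. measure_pmf.prob (Kc c w) {y. \<not> good c y w}
        + (\<Sum>v\<in>W2 - {w2}. measure_pmf.prob (Kc c w) {y. A (snd c v) y})
        + (\<Sum>v\<in>W1 - {w1}. measure_pmf.prob (Kc c w) {y. B (fst c v) (snd c w2) y}))"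
      by (intro integral_mono int)
    also have "\<dots> = ?E (\<lambda>c. measure_pmf.prob (Kc c w) {y. \<not> good c y w})
        + (\<Sum>v\<in>W2 - {w2}. ?E (\<lambda>c. measure_pmf.prob (Kc c w) {y. A (snd c v) y}))
        + (\<Sum>v\<in>W1 - {w1}. ?E (\<lambda>c. measure_pmf.prob (Kc c w) {y. B (fst c v) (snd c w2) y}))"
      by (simp add: int)
    also have "\<dots> \<le> ?\<delta> + (\<Sum>v\<in>W2 - {w2}. \<alpha>) + (\<Sum>v\<in>W1 - {w1}. \<beta>)"
    proof (intro add_mono sum_mono)
      have "map_pmf (\<lambda>c. (fst c w1, snd c w2)) C = pair_pmf P Q"
        using W w12
          map_pmf_pair_components[of "\<lambda>c. c w1" "\<lambda>c. c w2" C1 C2] by (simp add: C_def C1_def C2_def Pi_pmf_component)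
      then have "?\<delta> = measure_pmf.expectation (map_pmf (\<lambda>c. (fst c w1, snd c w2)) C)
            (\<lambda>(x, z). measure_pmf.prob (K x z) {y. \<not> (A z y \<and> B x z y)})" by simp
      then show "?E (\<lambda>c. measure_pmf.prob (Kc c w) {y. \<not> good c y w}) \<le> ?\<delta>"
        by (simp add: Kc_def good_def w_eq split_def)
    next
      fix v assume v: "v \<in> W2 - {w2}"
      \<comment> \<open>The output depends on the codewords of \<open>w1\<close> and
        \<open>w2\<close> only, so the wrong codeword \<open>z'\<close> is independent of it.
        Drawing \<open>z'\<close> first leaves the unconditional output law \<open>q\<close>, to
        which the change of measure applies.\<close>
      have law: "map_pmf (\<lambda>c. (fst c w1, snd c w2, snd c v)) C = pair_pmf P (pair_pmf Q Q)"
        using W w12 v Pi_pmf_two_components[of W2 w2 v undefined "\<lambda>_. Q"]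
          map_pmf_pair_components[of "\<lambda>c. c w1" "\<lambda>c. (c w2, c v)" C1 C2] by (simp add: C_def C1_def C2_def Pi_pmf_component)
      have "?E (\<lambda>c. measure_pmf.prob (Kc c w) {y. A (snd c v) y})
        = measure_pmf.expectation (pair_pmf P (pair_pmf Q Q)) (\<lambda>(x, z, z'). measure_pmf.prob (K x z) {y. A z' y})"
        unfolding law[symmetric] by (simp add: Kc_def w_eq split_def)
      also have "\<dots> = measure_pmf.prob (bind_pmf (pair_pmf P (pair_pmf Q Q))
          (\<lambda>(x, z, z'). map_pmf (Pair z') (K x z))) {(z', y). A z' y}"
        by (simp add: prob_bind_pmf split_def vimage_def)
      also have "bind_pmf (pair_pmf P (pair_pmf Q Q)) (\<lambda>(x, z, z'). map_pmf (Pair z') (K x z))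
          = bind_pmf Q (\<lambda>z'. map_pmf (Pair z') q)"
      proof -
        let ?F = "\<lambda>x z z'. map_pmf (Pair z') (K x z)"
        have "bind_pmf (pair_pmf P (pair_pmf Q Q)) (\<lambda>(x, z, z'). ?F x z z')
            = bind_pmf P (\<lambda>x. bind_pmf Q (\<lambda>z. bind_pmf Q (\<lambda>z'. ?F x z z')))"
          by (simp add: pair_pmf_def bind_assoc_pmf bind_return_pmf)
        also have "\<dots> = bind_pmf P (\<lambda>x. bind_pmf Q (\<lambda>z'. bind_pmf Q (\<lambda>z. ?F x z z')))"
          by (intro bind_pmf_cong refl bind_commute_pmf)
        also have "\<dots> = bind_pmf Q (\<lambda>z'. bind_pmf P (\<lambda>x. bind_pmf Q (\<lambda>z. ?F x z z')))"
          by (rule bind_commute_pmf)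
        also have "\<dots> = bind_pmf Q (\<lambda>z'. bind_pmf Q (\<lambda>z. bind_pmf P (\<lambda>x. ?F x z z')))"
          by (intro bind_pmf_cong refl bind_commute_pmf)
        finally show ?thesis by (simp add: q_def q2_def map_bind_pmf)
      qed
      also have "measure_pmf.prob \<dots> {(z', y). A z' y} = measure_pmf.expectation Q (\<lambda>z'. measure_pmf.prob q {y. A z' y})"
        by (simp add: prob_bind_pmf split_def vimage_def)
      also have "\<dots> \<le> measure_pmf.expectation Q (\<lambda>_. \<alpha>)"
      proof (intro integral_mono integrable_measure_pmf_finite)
        show "measure_pmf.prob q {y. A z' y} \<le> \<alpha>" for z'
          by (rule prob_le_of_pmf_le[where d' = "q2 z'"]) (use A fin_q \<alpha>\<beta> in auto)
      qed (use fin in auto)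
      finally show "?E (\<lambda>c. measure_pmf.prob (Kc c w) {y. A (snd c v) y}) \<le> \<alpha>" by simp
    next
      fix v assume v: "v \<in> W1 - {w1}"
      \<comment> \<open>Here the test sees the true \<open>z\<close>, so the output is independent
        of the wrong \<open>x'\<close> given \<open>z\<close>, with conditional law
        \<open>q2 z\<close>.\<close>
      have law: "map_pmf (\<lambda>c. ((fst c w1, fst c v), snd c w2)) C = pair_pmf (pair_pmf P P) Q"
        using W w12 v Pi_pmf_two_components[of W1 w1 v undefined "\<lambda>_. P"]
          map_pmf_pair_components[of "\<lambda>c. (c w1, c v)" "\<lambda>c. c w2" C1 C2] by (simp add: C_def C1_def C2_def Pi_pmf_component)
      have "?E (\<lambda>c. measure_pmf.prob (Kc c w) {y. B (fst c v) (snd c w2) y})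
        = measure_pmf.expectation (pair_pmf (pair_pmf P P) Q) (\<lambda>((x, x'), z). measure_pmf.prob (K x z) {y. B x' z y})"
        unfolding law[symmetric] by (simp add: Kc_def w_eq split_def)
      also have "\<dots> = measure_pmf.prob (bind_pmf (pair_pmf (pair_pmf P P) Q)
          (\<lambda>((x, x'), z). map_pmf (Pair (x', z)) (K x z))) {((x', z), y). B x' z y}"
        by (simp add: prob_bind_pmf split_def vimage_def)
      also have "bind_pmf (pair_pmf (pair_pmf P P) Q) (\<lambda>((x, x'), z). map_pmf (Pair (x', z)) (K x z))
          = bind_pmf (pair_pmf P Q) (\<lambda>(x', z). map_pmf (Pair (x', z)) (q2 z))"
      proof -
        let ?F = "\<lambda>x x' z. map_pmf (Pair (x', z)) (K x z)"
        have "bind_pmf (pair_pmf (pair_pmf P P) Q) (\<lambda>((x, x'), z). ?F x x' z)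
            = bind_pmf P (\<lambda>x. bind_pmf P (\<lambda>x'. bind_pmf Q (\<lambda>z. ?F x x' z)))"
          by (simp add: pair_pmf_def bind_assoc_pmf bind_return_pmf)
        also have "\<dots> = bind_pmf P (\<lambda>x'. bind_pmf P (\<lambda>x. bind_pmf Q (\<lambda>z. ?F x x' z)))"
          by (rule bind_commute_pmf)
        also have "\<dots> = bind_pmf P (\<lambda>x'. bind_pmf Q (\<lambda>z. bind_pmf P (\<lambda>x. ?F x x' z)))"
          by (intro bind_pmf_cong refl bind_commute_pmf)
        finally show ?thesis by (simp add: q2_def map_bind_pmf pair_pmf_def bind_assoc_pmf bind_return_pmf)
      qed
      also have "measure_pmf.prob \<dots> {((x', z), y). B x' z y}
          = measure_pmf.expectation (pair_pmf P Q) (\<lambda>(x', z). measure_pmf.prob (q2 z) {y. B x' z y})"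
        by (simp add: prob_bind_pmf split_def vimage_def)
      also have "\<dots> \<le> measure_pmf.expectation (pair_pmf P Q) (\<lambda>_. \<beta>)"
      proof (intro integral_mono integrable_measure_pmf_finite)
        have "measure_pmf.prob (q2 z) {y. B x' z y} \<le> \<beta>" for x' z
          by (rule prob_le_of_pmf_le[where d' = "K x' z"]) (use B fin_q \<alpha>\<beta> in auto)
        then show "(case c of (x', z) \<Rightarrow> measure_pmf.prob (q2 z) {y. B x' z y}) \<le> \<beta>" for c
          by (cases c) simp
      qed (use fin in auto)
      finally show "?E (\<lambda>c. measure_pmf.prob (Kc c w) {y. B (fst c v) (snd c w2) y}) \<le> \<beta>" by simp
    qed
    also have "\<dots> = ?\<delta> + (card W2 - 1) * \<alpha> + (card W1 - 1) * \<beta>"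
      using W w12 by simp
    finally show ?thesis .
  qed
  have "?E (\<lambda>c. \<Sum>w\<in>W1 \<times> W2. measure_pmf.prob (Kc c w) {y. g c y \<noteq> w})
      = (\<Sum>w\<in>W1 \<times> W2. ?E (\<lambda>c. measure_pmf.prob (Kc c w) {y. g c y \<noteq> w}))"
    by (simp add: int)
  also have "\<dots> \<le> (\<Sum>w\<in>W1 \<times> W2. ?\<delta> + (card W2 - 1) * \<alpha> + (card W1 - 1) * \<beta>)"
    by (rule sum_mono) (rule err)
  also have "\<dots> = card W1 * card W2 * (?\<delta> + (card W2 - 1) * \<alpha> + (card W1 - 1) * \<beta>)"
    by (simp add: card_cartesian_product)
  finally have le: "?E (\<lambda>c. \<Sum>w\<in>W1 \<times> W2. measure_pmf.prob (Kc c w) {y. g c y \<noteq> w}) \<le> \<dots>" .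
  obtain c where c: "c \<in> set_pmf C" and "(\<Sum>w\<in>W1 \<times> W2. measure_pmf.prob (Kc c w) {y. g c y \<noteq> w})
    \<le> ?E (\<lambda>c. \<Sum>w\<in>W1 \<times> W2. measure_pmf.prob (Kc c w) {y. g c y \<noteq> w})"
    using exists_le_expectation[OF fin_C, of "\<lambda>c. \<Sum>w\<in>W1 \<times> W2. measure_pmf.prob (Kc c w) {y. g c y \<noteq> w}"] by blast
  then have "(\<Sum>w\<in>W1 \<times> W2. measure_pmf.prob (Kc c w) {y. g c y \<noteq> w})
    \<le> card W1 * card W2 * (?\<delta> + (card W2 - 1) * \<alpha> + (card W1 - 1) * \<beta>)" using le by linarith
  moreover have "fst c w \<in> set_pmf P" if "w \<in> W1" for w
    using c that W by (auto simp: C_def C1_def set_Pi_pmf PiE_dflt_def)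
  moreover have "snd c w \<in> set_pmf Q" if "w \<in> W2" for w
    using c that W by (auto simp: C_def C2_def set_Pi_pmf PiE_dflt_def)
  ultimately show ?thesis
    using g_mem by (intro that[of "fst c" "snd c" "g c"]) (auto simp: Kc_def split_def)
qed

section \<open>Exponential tail bounds\<close>

lemma exp_minus_mult_tendsto_0:
  assumes "0 < (\<gamma> :: real)"
  shows "(\<lambda>n. exp (- (real n * \<gamma>))) \<longlonglongrightarrow> 0"
  using assms by (intro filterlim_compose[OF exp_at_bot] filterlim_compose[OF filterlim_uminus_at_bot_at_top]
      filterlim_at_top_mult_tendsto_pos[OF tendsto_const] filterlim_real_sequentially) simp

text \<open>Hoeffding's inequality: \<open>h\<close> is bounded on a finite alphabet, so the tail
  decays exponentially in \<open>n\<close>.\<close>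

lemma iid_lower_tail:
  fixes T :: "'s::finite pmf" and h :: "'s \<Rightarrow> real"
  assumes \<gamma>: "0 < \<gamma>"
  shows "(\<lambda>n::nat. measure_pmf.prob (Pi_pmf {1..n} d (\<lambda>_. T))
    {f. (\<Sum>t = 1..n. h (f t)) \<le> real n * (measure_pmf.expectation T h - \<gamma>)}) \<longlonglongrightarrow> 0"
proof -
  \<comment> \<open>The summand 1 keeps \<open>K\<close> positive when \<open>h\<close>
    vanishes.\<close>
  define K where "K = 1 + (\<Sum>s\<in>UNIV. \<bar>h s\<bar>)"
  have h_le: "\<bar>h s\<bar> \<le> K" for s
    using member_le_sum[of s UNIV "\<lambda>s. \<bar>h s\<bar>"] by (simp add: K_def)
  have K: "0 < K" unfolding K_def by (simp add: add_pos_nonneg sum_nonneg)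
  have le: "measure_pmf.prob (Pi_pmf {1..n} d (\<lambda>_. T))
      {f. (\<Sum>t = 1..n. h (f t)) \<le> real n * (measure_pmf.expectation T h - \<gamma>)} \<le> exp (- (n * (\<gamma>\<^sup>2 / (2 * K\<^sup>2))))"
    if n: "n \<ge> 1" for n :: nat
  proof -
    let ?M = "Pi_pmf {1..n} d (\<lambda>_. T)"
    interpret Hoeffding_ineq "measure_pmf ?M" "{1..n}" "\<lambda>t f. h (f t)" "\<lambda>_. - K" "\<lambda>_. K"
      "\<Sum>t = 1..n. measure_pmf.expectation ?M (\<lambda>f. h (f t))"
    proof unfold_locales
      have "prob_space.indep_vars ?M (\<lambda>_. count_space UNIV) (\<lambda>t f. f t) {1..n}"
        by (rule indep_vars_Pi_pmf) simp
      then show "prob_space.indep_vars ?M (\<lambda>_. borel) (\<lambda>t f. h (f t)) {1..n}"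
        by (rule prob_space.indep_vars_compose2[OF prob_space_measure_pmf]) simp
      show "AE f in ?M. h (f t) \<in> {- K..K}" for t
        using h_le by (auto simp: abs_le_iff minus_le_iff)
    qed simp_all
    have "measure_pmf.expectation ?M (\<lambda>f. h (f t)) = measure_pmf.expectation T h" if "t \<in> {1..n}" for t
    proof -
      have "measure_pmf.expectation ?M (\<lambda>f. h (f t)) = measure_pmf.expectation (map_pmf (\<lambda>f. f t) ?M) h"
        by simp
      then show ?thesis using that by (simp add: Pi_pmf_component)
    qed
    then have mean: "(\<Sum>t = 1..n. measure_pmf.expectation ?M (\<lambda>f. h (f t))) = n * measure_pmf.expectation T h"
      by simp
    have "measure_pmf.prob ?M {f \<in> space (measure_pmf ?M). (\<Sum>t = 1..n. h (f t)) \<le> real n * measure_pmf.expectation T h - real n * \<gamma>}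
        \<le> exp (- 2 * (n * \<gamma>)\<^sup>2 / (\<Sum>t = 1..n. (K - - K)\<^sup>2))"
      using Hoeffding_ineq_le[of "real n * \<gamma>"] K n \<gamma> unfolding mean by simp
    also have "- 2 * (n * \<gamma>)\<^sup>2 / (\<Sum>t = 1..n. (K - - K)\<^sup>2) = - (n * (\<gamma>\<^sup>2 / (2 * K\<^sup>2)))"
      using K n by (simp add: field_simps power2_eq_square)
    finally show ?thesis by (simp add: right_diff_distrib)
  qed
  have "(\<lambda>n. exp (- (real n * (\<gamma>\<^sup>2 / (2 * K\<^sup>2))))) \<longlonglongrightarrow> 0"
    using K \<gamma> by (intro exp_minus_mult_tendsto_0) simp
  then show ?thesis
    by (rule Lim_null_comparison[rotated]) (use le in \<open>auto intro!: eventually_sequentiallyI[of 1]\<close>)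
qed

text \<open>A block is \<open>undefined\<close> outside its index range, hence the default value
  \<open>undefined\<close> in the product laws on blocks.\<close>

lemma blocks_eq_PiE_dflt: "blocks n = PiE_dflt {1..n} undefined (\<lambda>_. UNIV)"
  by (auto simp: PiE_dflt_def PiE_def extensional_def)

lemma block_prob_eq_prob:
  fixes p :: "'a \<Rightarrow> 'b \<Rightarrow> 'c::finite pmf"
  shows "(\<Sum>y | y \<in> blocks n \<and> E y. block_prob p n x1 x2 y)
    = measure_pmf.prob (Pi_pmf {1..n} undefined (\<lambda>t. p (x1 t) (x2 t))) {y. E y}"
proof -
  let ?K = "Pi_pmf {1..n} undefined (\<lambda>t. p (x1 t) (x2 t))"
  have sub: "set_pmf ?K \<subseteq> blocks n"
    unfolding blocks_eq_PiE_dflt by (auto simp: set_Pi_pmf PiE_dflt_def)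
  have "measure_pmf.prob ?K {y. E y} = measure_pmf.prob ?K {y. y \<in> blocks n \<and> E y}"
    by (rule measure_pmf.finite_measure_eq_AE) (use sub in \<open>auto simp: AE_measure_pmf_iff\<close>)
  also have "\<dots> = (\<Sum>y | y \<in> blocks n \<and> E y. pmf ?K y)"
    by (rule measure_measure_pmf_finite) (rule finite_subset[OF _ finite_blocks], auto)
  also have "\<dots> = (\<Sum>y | y \<in> blocks n \<and> E y. block_prob p n x1 x2 y)"
    by (intro sum.cong refl) (auto simp: pmf_Pi block_prob_def PiE_def extensional_def)
  finally show ?thesis by simp
qed

section \<open>Message sets of rounded size\<close>

lemma index_set_one: "1 \<le> x \<Longrightarrow> 1 \<in> index_set x"
  by (simp add: index_set_def le_nat_iff le_floor_iff)

lemma finite_index_set: "finite (index_set x)"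
  by (simp add: index_set_def)

lemma card_index_set_le: "0 \<le> x \<Longrightarrow> real (card (index_set x)) \<le> x"
  by (simp add: index_set_def)

lemma one_le_two_powr_rate:
  assumes "0 \<le> (R :: real)"
  shows "1 \<le> 2 powr (real n * R)"
  using assms by (intro ge_one_powr_ge_zero) auto

text \<open>When \<open>I - 2 * \<gamma> \<le> 0\<close> there is a single message, so no competing codeword exists.\<close>

lemma competitors_bound:
  fixes I \<gamma> :: real and n :: nat
  assumes "0 < \<gamma>"
  shows "(card (index_set (2 powr (n * (max 0 (I - 2 * \<gamma>) / ln 2)))) - 1) * exp (- (n * (I - \<gamma>)))
    \<le> exp (- (n * \<gamma>))"
proof (cases "I - 2 * \<gamma> \<le> 0")
  case True
  then show ?thesis by (simp add: index_set_def)
next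
  case False
  let ?M = "card (index_set (2 powr (n * (max 0 (I - 2 * \<gamma>) / ln 2))))"
  have "real (?M - 1) \<le> real ?M" by simp
  also have "\<dots> \<le> 2 powr (n * (max 0 (I - 2 * \<gamma>) / ln 2))" by (rule card_index_set_le) simp
  also have "\<dots> = exp (n * (I - 2 * \<gamma>))" using False by (simp add: powr_def)
  finally have "(?M - 1) * exp (- (n * (I - \<gamma>))) \<le> exp (n * (I - 2 * \<gamma>)) * exp (- (n * (I - \<gamma>)))"
    by (rule mult_right_mono) simp
  also have "\<dots> = exp (- (n * \<gamma>))"
    by (simp add: exp_add[symmetric] algebra_simps)
  finally show ?thesis .
qed

lemma expectation_pmf_finite: "measure_pmf.expectation M f = (\<Sum>x\<in>UNIV. pmf M x * (f x :: real))"
  for M :: "'x::finite pmf"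
  by (subst integral_measure_pmf_real[of UNIV]) (auto simp: mult.commute)

text \<open>After taking logarithms, a failed threshold test on block likelihoods is a lower-tail
  event for a sum of letterwise log-likelihood ratios, the form treated by
  \<open>iid_lower_tail\<close>.\<close>

lemma sum_ln_quotient_le:
  fixes u v :: "nat \<Rightarrow> real"
  assumes pos: "\<And>t. t \<in> {1..n} \<Longrightarrow> 0 < u t" "\<And>t. t \<in> {1..n} \<Longrightarrow> 0 < v t"
    and gt: "\<not> prod u {1..n} \<le> exp (- s) * prod v {1..n}"
  shows "(\<Sum>t = 1..n. ln (v t / u t)) \<le> s"
proof -
  have prods: "0 < prod u {1..n}" "0 < prod v {1..n}" using pos by (auto intro: prod_pos)
  have "ln (exp (- s) * prod v {1..n}) \<le> ln (prod u {1..n})"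
    using gt prods by simp
  then have "- s + ln (prod v {1..n}) \<le> ln (prod u {1..n})"
    using prods by (simp add: ln_mult_pos)
  moreover have "ln (prod u {1..n}) = (\<Sum>t = 1..n. ln (u t))" "ln (prod v {1..n}) = (\<Sum>t = 1..n. ln (v t))"
    by (intro ln_prod less_imp_neq[OF pos(1), symmetric] less_imp_neq[OF pos(2), symmetric]; simp)+
  moreover have "(\<Sum>t = 1..n. ln (v t / u t)) = (\<Sum>t = 1..n. ln (v t) - ln (u t))"
    using pos by (intro sum.cong refl ln_divide_pos) auto
  ultimately show ?thesis by (simp add: sum_subtractf)
qed

text \<open>\<open>h1\<close> and \<open>h2\<close> are the information densities of
  \<open>X1;Y\<close> given \<open>X2\<close> and of \<open>X2;Y\<close>, and \<open>T\<close> is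
  the law of a letter triple. The two tails bound the failure of the sent pair. Thresholds sit
  \<open>\<gamma>\<close> below \<open>I1\<close> and \<open>I2\<close>, positive rates (in nats)
  \<open>2 * \<gamma>\<close> below, so each family of wrong codewords contributes at most
  \<open>exp (- (real n * \<gamma>))\<close>.\<close>

lemma exists_random_code:
  fixes p :: "'a::finite \<Rightarrow> 'b::finite \<Rightarrow> 'c::finite pmf" and P :: "'a pmf" and Q :: "'b pmf"
    and n :: nat and I1 I2 \<gamma> :: real
  defines "r2 \<equiv> \<lambda>b. bind_pmf P (\<lambda>a. p a b)"
  defines "r \<equiv> bind_pmf Q r2"
  defines "T \<equiv> bind_pmf P (\<lambda>a. bind_pmf Q (\<lambda>b. bind_pmf (p a b) (\<lambda>c. return_pmf (a, b, c))))"
  defines "h1 \<equiv> \<lambda>(a, b, c). ln (pmf (p a b) c / pmf (r2 b) c)"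
    and "h2 \<equiv> \<lambda>(a, b, c). ln (pmf (r2 b) c / pmf r c)"
  defines "tail \<equiv> \<lambda>h I. measure_pmf.prob (Pi_pmf {1..n} undefined (\<lambda>_. T))
    {f. (\<Sum>t = 1..n. h (f t)) \<le> real n * (I - \<gamma>)}"
  assumes Cin: "0 \<le> fst Cin" "0 \<le> snd Cin" and \<gamma>: "0 < \<gamma>"
  defines "R \<equiv> (max 0 (I1 - 2 * \<gamma>) / ln 2, max 0 (I2 - 2 * \<gamma>) / ln 2)"
  shows "\<exists>c. is_cf_code Cin (0, 0) R n c \<and>
    avg_error_prob p R n c \<le> tail h1 I1 + tail h2 I2 + 2 * exp (- (real n * \<gamma>))"
proof -
  define Pn where "Pn = Pi_pmf {1..n} undefined (\<lambda>_. P)"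
  define Qn where "Qn = Pi_pmf {1..n} undefined (\<lambda>_. Q)"
  define K where "K x z = Pi_pmf {1..n} undefined (\<lambda>t. p (x t) (z t))" for x z
  define q2 where "q2 z = bind_pmf Pn (\<lambda>x. K x z)" for z
  define q where "q = bind_pmf Qn q2"
  have q2: "q2 z = Pi_pmf {1..n} undefined (\<lambda>t. r2 (z t))" for z
    unfolding q2_def Pn_def K_def r2_def by (rule Pi_pmf_bind[symmetric]) simp
  have q: "q = Pi_pmf {1..n} undefined (\<lambda>t. r)"
    unfolding q_def q2 Qn_def r_def by (rule Pi_pmf_bind[symmetric]) simp
  define Tn where "Tn = Pi_pmf {1..n} undefined (\<lambda>_. T)"
  \<comment> \<open>A block of i.i.d. triples can be drawn as two codewords followed by the channel
    output, so the tails in the statement concern actual transmission.\<close>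
  have Tn: "Tn = bind_pmf Pn (\<lambda>x. bind_pmf Qn (\<lambda>z. map_pmf
      (\<lambda>y t. if t \<in> {1..n} then (x t, z t, y t) else undefined) (K x z)))"
  proof -
    have "Tn = bind_pmf Pn (\<lambda>x. Pi_pmf {1..n} undefined (\<lambda>t. bind_pmf Q (\<lambda>b.
        bind_pmf (p (x t) b) (\<lambda>c. return_pmf (x t, b, c)))))"
      unfolding Tn_def T_def Pn_def by (rule Pi_pmf_bind) simp
    also have "\<dots> = bind_pmf Pn (\<lambda>x. bind_pmf Qn (\<lambda>z. Pi_pmf {1..n} undefined (\<lambda>t.
        bind_pmf (p (x t) (z t)) (\<lambda>c. return_pmf (x t, z t, c)))))"
      unfolding Qn_def by (intro bind_pmf_cong refl Pi_pmf_bind) simp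
    also have "\<dots> = bind_pmf Pn (\<lambda>x. bind_pmf Qn (\<lambda>z. bind_pmf (K x z)
        (\<lambda>y. Pi_pmf {1..n} undefined (\<lambda>t. return_pmf (x t, z t, y t)))))"
      unfolding K_def by (intro bind_pmf_cong refl Pi_pmf_bind) simp
    finally show ?thesis by (simp add: map_pmf_def)
  qed
  define A where "A z y \<longleftrightarrow> pmf q y \<le> exp (- (real n * (I2 - \<gamma>))) * pmf (q2 z) y" for z y
  define B where "B x z y \<longleftrightarrow> pmf (q2 z) y \<le> exp (- (real n * (I1 - \<gamma>))) * pmf (K x z) y" for x z y
  let ?W1 = "index_set (2 powr (real n * fst R))" and ?W2 = "index_set (2 powr (real n * snd R))"
  let ?\<delta> = "measure_pmf.expectation (pair_pmf Pn Qn)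
            (\<lambda>(x, z). measure_pmf.prob (K x z) {y. \<not> (A z y \<and> B x z y)})"
  have R: "0 \<le> fst R" "0 \<le> snd R" by (auto simp: R_def)
  have fin: "finite (set_pmf (Pi_pmf {1..n} undefined s))" for s :: "nat \<Rightarrow> 'd::finite pmf"
    by (simp add: set_Pi_pmf finite_PiE_dflt)
  have ne: "?W1 \<noteq> {}" "?W2 \<noteq> {}"
    using index_set_one[OF one_le_two_powr_rate[OF R(1)]] index_set_one[OF one_le_two_powr_rate[OF R(2)]] by blast+
  obtain c1 c2 g where c1: "\<And>w. w \<in> ?W1 \<Longrightarrow> c1 w \<in> set_pmf Pn" and c2: "\<And>w. w \<in> ?W2 \<Longrightarrow> c2 w \<in> set_pmf Qn"
    and g: "\<And>y. g y \<in> ?W1 \<times> ?W2"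
    and le: "(\<Sum>w\<in>?W1 \<times> ?W2. measure_pmf.prob (K (c1 (fst w)) (c2 (snd w))) {y. g y \<noteq> w})
      \<le> card ?W1 * card ?W2 * (?\<delta> + (card ?W2 - 1) * exp (- (real n * (I2 - \<gamma>)))
        + (card ?W1 - 1) * exp (- (real n * (I1 - \<gamma>))))"
  proof (rule random_coding[of Pn Qn K ?W1 ?W2 A "exp (- (real n * (I2 - \<gamma>)))" B "exp (- (real n * (I1 - \<gamma>)))"])
    show "finite (set_pmf Pn)" "finite (set_pmf Qn)" "finite (set_pmf (K x z))" for x z
      by (simp_all only: Pn_def Qn_def K_def fin)
  qed (auto simp: finite_index_set ne A_def B_def q_def q2_def[abs_def])
  have \<delta>_le: "?\<delta> \<le> tail h1 I1 + tail h2 I2"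
  proof -
    let ?J = "bind_pmf (pair_pmf Pn Qn) (\<lambda>(x, z). map_pmf (\<lambda>y. (x, z, y)) (K x z))"
    let ?F = "\<lambda>(x, z, y) t. if t \<in> {1..n} then (x t, z t, y t) else undefined"
    have "?\<delta> = measure_pmf.prob ?J {(x, z, y). \<not> (A z y \<and> B x z y)}"
      by (simp add: prob_bind_pmf split_def vimage_def)
    also have "\<dots> \<le> measure_pmf.prob ?J (?F -` {f. (\<Sum>t = 1..n. h1 (f t)) \<le> real n * (I1 - \<gamma>)}
        \<union> ?F -` {f. (\<Sum>t = 1..n. h2 (f t)) \<le> real n * (I2 - \<gamma>)})"
    proof (rule measure_pmf.finite_measure_mono_AE)
      show "AE \<omega> in ?J. \<omega> \<in> {(x, z, y). \<not> (A z y \<and> B x z y)} \<longrightarrow>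
          \<omega> \<in> ?F -` {f. (\<Sum>t = 1..n. h1 (f t)) \<le> real n * (I1 - \<gamma>)}
          \<union> ?F -` {f. (\<Sum>t = 1..n. h2 (f t)) \<le> real n * (I2 - \<gamma>)}"
        unfolding AE_measure_pmf_iff
      proof (intro ballI impI, clarify)
        fix x z y
        assume supp: "(x, z, y) \<in> set_pmf ?J"
          and nB: "(x, z, y) \<notin> ?F -` {f. (\<Sum>t = 1..n. h2 (f t)) \<le> real n * (I2 - \<gamma>)}"
          and nA: "\<not> (A z y \<and> B x z y)"
        show "(x, z, y) \<in> ?F -` {f. (\<Sum>t = 1..n. h1 (f t)) \<le> real n * (I1 - \<gamma>)}"
        proof -
          have y: "y \<in> set_pmf (K x z)" and x: "x \<in> set_pmf Pn" and z: "z \<in> set_pmf Qn"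
            using supp by auto
          have out: "y t = undefined" if "t \<notin> {1..n}" for t
            using y that unfolding K_def by (auto simp: set_Pi_pmf PiE_dflt_def)
          \<comment> \<open>On the support all three likelihoods are positive, as
            \<open>sum_ln_quotient_le\<close> requires.\<close>
          have p_pos: "0 < pmf (p (x t) (z t)) (y t)"
            and r2_pos: "0 < pmf (r2 (z t)) (y t)" and r_pos: "0 < pmf r (y t)" if t: "t \<in> {1..n}" for t
          proof -
            have "y t \<in> set_pmf (p (x t) (z t))" "x t \<in> set_pmf P" "z t \<in> set_pmf Q"
              using x y z t by (auto simp: K_def Pn_def Qn_def set_Pi_pmf PiE_dflt_def)
            moreover from this have "y t \<in> set_pmf (r2 (z t))" by (auto simp: r2_def)
            moreover from this calculation have "y t \<in> set_pmf r" by (auto simp: r_def)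
            ultimately show "0 < pmf (p (x t) (z t)) (y t)" "0 < pmf (r2 (z t)) (y t)" "0 < pmf r (y t)"
              by (auto intro: pmf_positive)
          qed
          have pmfs: "pmf (K x z) y = (\<Prod>t = 1..n. pmf (p (x t) (z t)) (y t))"
            "pmf (q2 z) y = (\<Prod>t = 1..n. pmf (r2 (z t)) (y t))" "pmf q y = (\<Prod>t = 1..n. pmf r (y t))"
            unfolding K_def q2 q by (rule pmf_Pi'; use out in simp)+
          have F: "h1 (?F (x, z, y) t) = ln (pmf (p (x t) (z t)) (y t) / pmf (r2 (z t)) (y t))"
            "h2 (?F (x, z, y) t) = ln (pmf (r2 (z t)) (y t) / pmf r (y t))" if "t \<in> {1..n}" for t
            using that by (simp_all add: h1_def h2_def)
          have "A z y"
          proof (rule ccontr)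
            assume "\<not> A z y"
            then have "(\<Sum>t = 1..n. ln (pmf (r2 (z t)) (y t) / pmf r (y t))) \<le> real n * (I2 - \<gamma>)"
              unfolding A_def pmfs by (intro sum_ln_quotient_le r_pos r2_pos)
            then show False using nB F(2) by simp
          qed
          then have "\<not> B x z y" using nA by simp
          then have "(\<Sum>t = 1..n. ln (pmf (p (x t) (z t)) (y t) / pmf (r2 (z t)) (y t))) \<le> real n * (I1 - \<gamma>)"
            unfolding B_def pmfs by (intro sum_ln_quotient_le p_pos r2_pos)
          then show ?thesis using F(1) by simp
        qed
      qed
    qed simp
    also have "\<dots> \<le> measure_pmf.prob ?J (?F -` {f. (\<Sum>t = 1..n. h1 (f t)) \<le> real n * (I1 - \<gamma>)})
        + measure_pmf.prob ?J (?F -` {f. (\<Sum>t = 1..n. h2 (f t)) \<le> real n * (I2 - \<gamma>)})"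
      by (rule measure_Un_le) simp_all
    also have "\<dots> = measure_pmf.prob (map_pmf ?F ?J) {f. (\<Sum>t = 1..n. h1 (f t)) \<le> real n * (I1 - \<gamma>)}
        + measure_pmf.prob (map_pmf ?F ?J) {f. (\<Sum>t = 1..n. h2 (f t)) \<le> real n * (I2 - \<gamma>)}"
      by simp
    also have "map_pmf ?F ?J = Tn"
      unfolding Tn by (simp add: pair_pmf_def bind_assoc_pmf bind_return_pmf map_bind_pmf pmf.map_comp o_def)
    finally show ?thesis by (simp only: Tn_def tail_def)
  qed
  \<comment> \<open>A link of zero output capacity has the single index 1, so the facilitator is
    constant and both encoders ignore it.\<close>
  define code where "code = \<lparr>cf_in1 = \<lambda>_. 1, cf_in2 = \<lambda>_. 1, cf_out1 = \<lambda>_ _. 1, cf_out2 = \<lambda>_ _. 1,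
    enc1 = \<lambda>w _. c1 w, enc2 = \<lambda>w _. c2 w, dec = g\<rparr>"
  have "c1 w \<in> blocks n" if "w \<in> ?W1" for w
    using c1[OF that] unfolding blocks_eq_PiE_dflt Pn_def by (auto simp: set_Pi_pmf PiE_dflt_def)
  moreover have "c2 w \<in> blocks n" if "w \<in> ?W2" for w
    using c2[OF that] unfolding blocks_eq_PiE_dflt Qn_def by (auto simp: set_Pi_pmf PiE_dflt_def)
  moreover have "1 \<in> index_set (2 powr (real n * fst Cin))" "1 \<in> index_set (2 powr (real n * snd Cin))"
    "1 \<in> index_set (2 powr (real n * 0))"
    by (intro index_set_one one_le_two_powr_rate Cin order_refl)+
  ultimately have "is_cf_code Cin (0, 0) R n code"
    using g unfolding is_cf_code_def Let_def code_def by (auto simp del: One_nat_def)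
  moreover have "avg_error_prob p R n code \<le> tail h1 I1 + tail h2 I2 + 2 * exp (- (real n * \<gamma>))"
  proof -
    let ?B = "tail h1 I1 + tail h2 I2 + 2 * exp (- (real n * \<gamma>))"
    have B: "0 \<le> ?B" by (simp add: tail_def add_nonneg_nonneg)
    have "?\<delta> + (card ?W2 - 1) * exp (- (real n * (I2 - \<gamma>))) + (card ?W1 - 1) * exp (- (real n * (I1 - \<gamma>))) \<le> ?B"
      using \<delta>_le competitors_bound[OF \<gamma>, of n I1] competitors_bound[OF \<gamma>, of n I2] by (simp add: R_def)
    then have "(\<Sum>w\<in>?W1 \<times> ?W2. measure_pmf.prob (K (c1 (fst w)) (c2 (snd w))) {y. g y \<noteq> w})
        \<le> card ?W1 * card ?W2 * ?B"
      using order_trans[OF le mult_left_mono] by simp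
    \<comment> \<open>Rounding down makes the message sets no larger than their nominal sizes, so
      the error normalised by the nominal sizes is at most the true mean.\<close>
    also have "\<dots> \<le> (2 powr (real n * fst R) * 2 powr (real n * snd R)) * ?B"
    proof (rule mult_right_mono[OF _ B])
      show "real (card ?W1 * card ?W2) \<le> 2 powr (real n * fst R) * 2 powr (real n * snd R)"
        unfolding of_nat_mult by (intro mult_mono card_index_set_le) simp_all
    qed
    also have "\<dots> = 2 powr (real n * (fst R + snd R)) * ?B"
      by (simp add: powr_add distrib_left)
    also have "(\<Sum>w\<in>?W1 \<times> ?W2. measure_pmf.prob (K (c1 (fst w)) (c2 (snd w))) {y. g y \<noteq> w})
        = (\<Sum>w1\<in>?W1. \<Sum>w2\<in>?W2. error_prob p n code w1 w2)"
      unfolding sum.cartesian_product' error_prob_def Let_def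
      by (simp add: code_def block_prob_eq_prob K_def del: One_nat_def)
    finally have "avg_error_prob p R n code
        \<le> 2 powr (- (real n * (fst R + snd R))) * (2 powr (real n * (fst R + snd R)) * ?B)"
      unfolding avg_error_prob_def by (intro mult_left_mono) auto
    also have "\<dots> = ?B"
      unfolding mult.assoc[symmetric] powr_add[symmetric] by simp
    finally show ?thesis .
  qed
  ultimately show ?thesis by blast
qed

lemma bind_pmf_positive: "0 < pmf (f x) y \<Longrightarrow> 0 < pmf M x \<Longrightarrow> 0 < pmf (bind_pmf M f) y"
  by (rule pmf_positive) (auto simp: set_pmf_iff intro!: bexI[of _ x])

lemma expectation_bind_finite:
  fixes M :: "'x::finite pmf" and f :: "'x \<Rightarrow> 'y::finite pmf" and h :: "'y \<Rightarrow> real"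
  shows "measure_pmf.expectation (bind_pmf M f) h = (\<Sum>x\<in>UNIV. pmf M x * measure_pmf.expectation (f x) h)"
  by (subst pmf_expectation_bind[of UNIV]) auto

text \<open>With \<open>I1 = I(X1;Y|X2)\<close> and \<open>I2 = I(X2;Y)\<close> the chain rule gives
  \<open>I1 + I2 = I(X1,X2;Y)\<close>. Backing off by \<open>2 * \<gamma>\<close> in each rate loses
  \<open>4 * \<gamma>\<close>, and truncation at 0 can only raise the sum.\<close>

lemma achievable_of_product:
  fixes p :: "'a::finite \<Rightarrow> 'b::finite \<Rightarrow> 'c::finite pmf" and P :: "'a pmf" and Q :: "'b pmf"
  assumes Cin: "0 \<le> fst Cin" "0 \<le> snd Cin" and \<gamma>: "0 < \<gamma>"
  obtains R where "achievable_avg p Cin (0, 0) R"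
    "(mac_info p (pmf P) (pmf Q) - 4 * \<gamma>) / ln 2 \<le> fst R + snd R"
proof -
  define r2 where "r2 b = bind_pmf P (\<lambda>a. p a b)" for b
  define r where "r = bind_pmf Q r2"
  define T where "T = bind_pmf P (\<lambda>a. bind_pmf Q (\<lambda>b. bind_pmf (p a b) (\<lambda>c. return_pmf (a, b, c))))"
  define h1 where "h1 = (\<lambda>(a :: 'a, b, c). ln (pmf (p a b) c / pmf (r2 b) c))"
  define h2 where "h2 = (\<lambda>(a :: 'a, b, c). ln (pmf (r2 b) c / pmf r c))"
  define I1 where "I1 = measure_pmf.expectation T h1"
  define I2 where "I2 = measure_pmf.expectation T h2"
  define tail where "tail n h I = measure_pmf.prob (Pi_pmf {1..n} undefined (\<lambda>_. T))
    {f. (\<Sum>t = 1..n. h (f t)) \<le> real n * (I - \<gamma>)}" for n h I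
  define R where "R = (max 0 (I1 - 2 * \<gamma>) / ln 2, max 0 (I2 - 2 * \<gamma>) / ln 2)"
  note defs = r2_def[abs_def] r_def T_def h1_def h2_def tail_def R_def
  have "\<exists>c. is_cf_code Cin (0, 0) R n c \<and>
      avg_error_prob p R n c \<le> tail n h1 I1 + tail n h2 I2 + 2 * exp (- (real n * \<gamma>))" for n
    unfolding defs by (rule exists_random_code[OF Cin \<gamma>])
  then obtain c where c: "\<And>n. is_cf_code Cin (0, 0) R n (c n)"
    "\<And>n. avg_error_prob p R n (c n) \<le> tail n h1 I1 + tail n h2 I2 + 2 * exp (- (real n * \<gamma>))"
    by metis
  have "(\<lambda>n. tail n h1 I1 + tail n h2 I2 + 2 * exp (- (real n * \<gamma>))) \<longlonglongrightarrow> 0 + 0 + 2 * 0"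
    unfolding tail_def I1_def I2_def
    by (intro tendsto_add tendsto_mult tendsto_const iid_lower_tail exp_minus_mult_tendsto_0 \<gamma>)
  then have lim: "(\<lambda>n. tail n h1 I1 + tail n h2 I2 + 2 * exp (- (real n * \<gamma>))) \<longlonglongrightarrow> 0" by simp
  have nonneg: "0 \<le> avg_error_prob p R n (c n)" for n
    unfolding avg_error_prob_def error_prob_def Let_def
    by (intro mult_nonneg_nonneg sum_nonneg block_prob_nonneg) simp
  have "(\<lambda>n. avg_error_prob p R n (c n)) \<longlonglongrightarrow> 0"
    by (rule tendsto_sandwich[OF _ _ tendsto_const lim]) (use nonneg c(2) in auto)
  then have "achievable_avg p Cin (0, 0) R"
    using c(1) unfolding achievable_avg_def R_def by auto
  moreover have "(mac_info p (pmf P) (pmf Q) - 4 * \<gamma>) / ln 2 \<le> fst R + snd R"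
  proof -
    have ET: "measure_pmf.expectation T h
        = (\<Sum>a\<in>UNIV. \<Sum>b\<in>UNIV. \<Sum>c\<in>UNIV. pmf P a * pmf Q b * pmf (p a b) c * h (a, b, c))" for h :: "_ \<Rightarrow> real"
      unfolding T_def by (simp add: expectation_bind_finite sum_distrib_left mult.assoc)
    have r: "pmf r c = out_law p (pmf P) (pmf Q) c" for c
      unfolding r_def r2_def out_law_def pmf_bind expectation_pmf_finite sum_distrib_left
      by (subst sum.swap) (simp add: mult_ac)
    have "I1 + I2 = (\<Sum>a\<in>UNIV. \<Sum>b\<in>UNIV. \<Sum>c\<in>UNIV. pmf P a * pmf Q b *
        (pmf (p a b) c * ln (pmf (p a b) c / pmf r c)))"
      unfolding I1_def I2_def ET sum.distrib[symmetric]
    proof (intro sum.cong refl)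
      fix a b c
      show "pmf P a * pmf Q b * pmf (p a b) c * h1 (a, b, c) + pmf P a * pmf Q b * pmf (p a b) c * h2 (a, b, c)
        = pmf P a * pmf Q b * (pmf (p a b) c * ln (pmf (p a b) c / pmf r c))"
      proof (cases "pmf P a * pmf Q b * pmf (p a b) c = 0")
        case False
        then have pos: "0 < pmf P a" "0 < pmf Q b" "0 < pmf (p a b) c" by (auto simp: less_le)
        have r2: "0 < pmf (r2 b) c" unfolding r2_def by (rule bind_pmf_positive[where x = a]) (rule pos)+
        have "0 < pmf r c" unfolding r_def by (rule bind_pmf_positive[where x = b]) (rule r2 pos)+
        then show ?thesis using pos r2 by (simp add: h1_def h2_def ln_divide_pos algebra_simps)
      qed auto
    qed
    also have "\<dots> = mac_info p (pmf P) (pmf Q)"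
      unfolding mac_info_def rel_ent_def r[abs_def] sum_distrib_left ..
    finally have "mac_info p (pmf P) (pmf Q) - 4 * \<gamma> \<le> max 0 (I1 - 2 * \<gamma>) + max 0 (I2 - 2 * \<gamma>)"
      by linarith
    then show ?thesis by (simp add: R_def divide_right_mono flip: add_divide_distrib)
  qed
  ultimately show ?thesis by (rule that)
qed

section \<open>Continuity of the sum capacity\<close>

text \<open>From 1 on, rounding down costs at most a factor 2; the two message sets together produce
  the factor 4 in the proof of \<open>achievable_rate_le\<close>.\<close>

lemma card_index_set_ge:
  assumes "1 \<le> x"
  shows "x / 2 \<le> real (card (index_set x))"
proof -
  have "1 \<le> \<lfloor>x\<rfloor>" using assms by (simp add: le_floor_iff)
  then have "real (card (index_set x)) = of_int \<lfloor>x\<rfloor>" by (simp add: index_set_def)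
  moreover have "x < of_int \<lfloor>x\<rfloor> + 1" by linarith
  moreover have "1 \<le> real_of_int \<lfloor>x\<rfloor>" using \<open>1 \<le> \<lfloor>x\<rfloor>\<close> by linarith
  ultimately show ?thesis by linarith
qed

text \<open>\<open>converse_bound\<close> for each block, divided by \<open>n\<close>, in the limit:
  Fano's constant and the rounding losses vanish, while \<open>ln (card ZS)\<close> is at most
  \<open>n\<close> times the output capacities, in nats.\<close>

lemma achievable_rate_le:
  fixes p :: "'a::finite \<Rightarrow> 'b::finite \<Rightarrow> 'c::finite pmf"
  assumes Cout: "0 \<le> fst Cout" "0 \<le> snd Cout" and ach: "achievable_avg p Cin Cout R"
    and J: "\<And>P Q. (\<And>a. 0 \<le> P a) \<Longrightarrow> sum P UNIV = 1 \<Longrightarrow> (\<And>b. 0 \<le> Q b) \<Longrightarrow> sum Q UNIV = 1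
      \<Longrightarrow> mac_info p P Q \<le> J"
    and \<gamma>: "0 < \<gamma>" "\<gamma> < 1" and e: "0 < e" and s: "0 < s" "s * L \<le> 1"
    and L: "L = - ln (\<gamma> / CARD('c))"
  shows "(fst R + snd R) * ln 2 \<le> (fst Cout + snd Cout) * (ln 2 * (1 + ln (CARD('a \<times> 'b)) / e))
    + (e / s + s * L\<^sup>2 + J - ln (1 - \<gamma>))"
    (is "?S * ln 2 \<le> ?X")
proof -
  from ach obtain c where R: "0 \<le> fst R" "0 \<le> snd R"
    and code: "\<And>n. n \<ge> 1 \<Longrightarrow> is_cf_code Cin Cout R n (c n)"
    and lim: "(\<lambda>n. avg_error_prob p R n (c n)) \<longlonglongrightarrow> 0"
    unfolding achievable_avg_def by auto
  let ?err = "\<lambda>n. avg_error_prob p R n (c n)"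
  \<comment> \<open>Since \<open>M\<close> is at least a quarter of
    \<open>2 powr (real n * ?S)\<close>, the true mean error \<open>Pe\<close> is at most
    \<open>4 * ?err n\<close>, and \<open>ln M\<close> falls short of \<open>n * ?S * ln 2\<close>
    by at most \<open>2 * ln 2\<close>. The side condition keeps the factor on the left
    nonnegative.\<close>
  have bound: "(1 - 4 * ?err n) * (?S * ln 2 - 2 * ln 2 / n) \<le> ln 2 / n + ?X"
    if n: "n \<ge> 1" and small: "4 * ?err n \<le> 1" for n
  proof -
    let ?c = "c n"
    define W1 where "W1 = index_set (2 powr (real n * fst R))"
    define W2 where "W2 = index_set (2 powr (real n * snd R))"
    define Z1 where "Z1 = index_set (2 powr (real n * fst Cout))"
    define Z2 where "Z2 = index_set (2 powr (real n * snd Cout))"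
    define Z where "Z w = (cf_out1 ?c (cf_in1 ?c (fst w)) (cf_in2 ?c (snd w)),
      cf_out2 ?c (cf_in1 ?c (fst w)) (cf_in2 ?c (snd w)))" for w
    define M where "M = real (card W1 * card W2)"
    define Pe where "Pe = (\<Sum>w\<in>W1 \<times> W2. \<Sum>y | y \<in> blocks n \<and> dec ?c y \<noteq> w.
      block_prob p n (enc1 ?c (fst w) (fst (Z w))) (enc2 ?c (snd w) (snd (Z w))) y) / (card W1 * card W2)"
    have ge1: "1 \<in> W1" "1 \<in> W2" "1 \<in> Z1" "1 \<in> Z2"
      unfolding W1_def W2_def Z1_def Z2_def by (intro index_set_one one_le_two_powr_rate R Cout)+
    have fin: "finite W1" "finite W2" "finite Z1" "finite Z2"
      unfolding W1_def W2_def Z1_def Z2_def by (rule finite_index_set)+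
    have Z: "Z ` (W1 \<times> W2) \<subseteq> Z1 \<times> Z2"
      using code[OF n] unfolding is_cf_code_def Let_def Z_def W1_def W2_def Z1_def Z2_def
      by (auto simp: Pi_iff)
    have conv: "(1 - Pe) * ln M \<le> ln 2 + ln (card (Z1 \<times> Z2)) + ln (card (Z1 \<times> Z2)) / e * ln (CARD('a \<times> 'b))
        + n * (e / s + s * L\<^sup>2 + J - ln (1 - \<gamma>))"
      using ge1 fin
      by (intro converse_bound[where ?W1.0 = W1 and ?W2.0 = W2 and Z = Z and p = p
            and ?f1.0 = "\<lambda>w z. enc1 ?c w (fst z)" and ?f2.0 = "\<lambda>w z. enc2 ?c w (snd z)" and dc = "dec ?c"]
          J Z \<gamma> e s L M_def) (auto simp: Pe_def)
    have M_ge: "2 powr (real n * ?S) / 4 \<le> M"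
    proof -
      have "(2 powr (real n * fst R) / 2) * (2 powr (real n * snd R) / 2) \<le> real (card W1) * real (card W2)"
        unfolding W1_def W2_def
        by (intro mult_mono card_index_set_ge one_le_two_powr_rate R) auto
      then show ?thesis by (simp add: M_def distrib_left powr_add)
    qed
    have M_pos: "1 \<le> M"
    proof -
      have "1 \<le> card W1" "1 \<le> card W2" using ge1 fin by (auto simp: Suc_le_eq card_gt_0_iff)
      then show ?thesis unfolding M_def by (metis mult_le_mono nat_mult_1 of_nat_1 of_nat_le_iff)
    qed
    have "ln (2 powr (real n * ?S) / 4) \<le> ln M" using M_ge M_pos by (subst ln_le_cancel_iff) auto
    moreover have "ln (2 powr (real n * ?S) / 4) = n * ?S * ln 2 - 2 * ln 2"
      using ln_realpow[of 2 2] by (simp add: ln_div ln_powr)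
    ultimately have ln_M: "n * ?S * ln 2 - 2 * ln 2 \<le> ln M" by simp
    have "Pe \<le> 4 * ?err n"
    proof -
      define E where "E = (\<Sum>w1\<in>W1. \<Sum>w2\<in>W2. error_prob p n ?c w1 w2)"
      have E: "0 \<le> E" unfolding E_def error_prob_def Let_def by (intro sum_nonneg block_prob_nonneg)
      have "Pe = E / M"
        unfolding Pe_def E_def M_def sum.cartesian_product' error_prob_def Let_def Z_def by simp
      also have "\<dots> \<le> E / (2 powr (real n * ?S) / 4)"
        using E M_ge by (intro divide_left_mono mult_pos_pos) (use M_pos in auto)
      also have "\<dots> = 4 * (1 / 2 powr (real n * ?S) * E)" by simp
      also have "1 / 2 powr (real n * ?S) * E = ?err n"
        unfolding avg_error_prob_def E_def W1_def W2_def powr_minus_divide ..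
      finally show ?thesis .
    qed
    then have "(1 - 4 * ?err n) * ln M \<le> (1 - Pe) * ln M"
      using M_pos by (intro mult_right_mono) simp_all
    moreover have "(1 - 4 * ?err n) * (n * ?S * ln 2 - 2 * ln 2) \<le> (1 - 4 * ?err n) * ln M"
      using small by (intro mult_left_mono[OF ln_M]) simp
    moreover note conv
    moreover have "ln (card (Z1 \<times> Z2)) + ln (card (Z1 \<times> Z2)) / e * ln (CARD('a \<times> 'b))
        \<le> n * (fst Cout + snd Cout) * ln 2 + n * (fst Cout + snd Cout) * ln 2 / e * ln (CARD('a \<times> 'b))"
    proof -
      have pos: "1 \<le> card Z1" "1 \<le> card Z2" using ge1 fin by (auto simp: Suc_le_eq card_gt_0_iff)
      have "ln (card (Z1 \<times> Z2)) = ln (card Z1) + ln (card Z2)"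
        using pos by (simp add: card_cartesian_product ln_mult_pos)
      also have "\<dots> \<le> ln (2 powr (real n * fst Cout)) + ln (2 powr (real n * snd Cout))"
        using pos card_index_set_le[of "2 powr (real n * fst Cout)"] card_index_set_le[of "2 powr (real n * snd Cout)"]
        by (intro add_mono) (simp_all add: Z1_def Z2_def del: ln_powr)
      also have "\<dots> = n * (fst Cout + snd Cout) * ln 2" by (simp add: ln_powr algebra_simps)
      finally have le: "ln (card (Z1 \<times> Z2)) \<le> n * (fst Cout + snd Cout) * ln 2" .
      moreover have "1 \<le> real (CARD('a \<times> 'b))"
        using zero_less_card_finite[where 'a = "'a \<times> 'b"] by linarith
      ultimately show ?thesis using e
        by (intro add_mono mult_right_mono divide_right_mono ln_ge_zero) auto
    qed
    moreover have "n * (fst Cout + snd Cout) * ln 2 + n * (fst Cout + snd Cout) * ln 2 / e * ln (CARD('a \<times> 'b))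
        = n * ((fst Cout + snd Cout) * (ln 2 * (1 + ln (CARD('a \<times> 'b)) / e)))"
      by (simp add: algebra_simps)
    ultimately have "(1 - 4 * ?err n) * (n * ?S * ln 2 - 2 * ln 2) \<le> ln 2 + n * ?X"
      unfolding distrib_left[of "real n"] by linarith
    then have "(1 - 4 * ?err n) * (n * ?S * ln 2 - 2 * ln 2) / n \<le> (ln 2 + n * ?X) / n"
      by (rule divide_right_mono) simp
    moreover have "x * (n * y * z - v) / n = x * (y * z - v / n)" "(v + n * x) / n = v / n + x"
      for x y z v :: real
      using n by (simp_all add: field_simps)
    ultimately show ?thesis by simp
  qed
  have lhs: "(\<lambda>n. (1 - 4 * ?err n) * (?S * ln 2 - 2 * ln 2 / n)) \<longlonglongrightarrow> (1 - 4 * 0) * (?S * ln 2 - 0)"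
    by (intro tendsto_mult tendsto_diff tendsto_const lim lim_const_over_n)
  have rhs: "(\<lambda>n. ln 2 / real n + ?X) \<longlonglongrightarrow> 0 + ?X"
    by (intro tendsto_add tendsto_const lim_const_over_n)
  have "eventually (\<lambda>n. ?err n < 1 / 4) sequentially"
    by (rule order_tendstoD(2)[OF lim]) simp
  then have "eventually (\<lambda>n. (1 - 4 * ?err n) * (?S * ln 2 - 2 * ln 2 / n) \<le> ln 2 / n + ?X) sequentially"
    using eventually_ge_at_top[of 1] by eventually_elim (rule bound; simp)
  then have "(1 - 4 * 0) * (?S * ln 2 - 0) \<le> 0 + ?X"
    by (intro tendsto_le[OF sequentially_bot rhs lhs])
  then show ?thesis by simp
qed

text \<open>The three error terms get \<open>\<epsilon> / 3\<close> each. All constants, including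
  the slope \<open>D\<close>, are fixed before the capacities are quantified, so the bound tends to
  \<open>J + \<epsilon>\<close> as the output links close.\<close>

lemma converse_near_zero:
  fixes p :: "'a::finite \<Rightarrow> 'b::finite \<Rightarrow> 'c::finite pmf"
  assumes J: "\<And>P Q. (\<And>a. 0 \<le> P a) \<Longrightarrow> sum P UNIV = 1 \<Longrightarrow> (\<And>b. 0 \<le> Q b) \<Longrightarrow> sum Q UNIV = 1
      \<Longrightarrow> mac_info p P Q \<le> J"
    and \<epsilon>: "0 < \<epsilon>"
  shows "\<exists>D\<ge>0. \<forall>Cin Cout R. 0 \<le> fst Cout \<longrightarrow> 0 \<le> snd Cout \<longrightarrow> achievable_avg p Cin Cout R
    \<longrightarrow> (fst R + snd R) * ln 2 \<le> J + \<epsilon> + (fst Cout + snd Cout) * D"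
proof -
  \<comment> \<open>In order of dependence: \<open>\<gamma>\<close> makes
    \<open>- ln (1 - \<gamma>) = \<epsilon> / 3\<close> and determines \<open>L\<close>, then
    \<open>s\<close> is small enough for \<open>s * L \<le> 1\<close> and
    \<open>s * L\<^sup>2 \<le> \<epsilon> / 3\<close>, and \<open>e\<close> makes
    \<open>e / s = \<epsilon> / 3\<close>.\<close>
  define \<gamma> where "\<gamma> = 1 - exp (- \<epsilon> / 3)"
  define L where "L = - ln (\<gamma> / CARD('c))"
  define s where "s = min (1 / (1 + \<bar>L\<bar>)) (\<epsilon> / 3 / (1 + L\<^sup>2))"
  define e where "e = s * (\<epsilon> / 3)"
  define D where "D = ln 2 * (1 + ln (CARD('a \<times> 'b)) / e)"
  have \<gamma>: "0 < \<gamma>" "\<gamma> < 1" "- ln (1 - \<gamma>) = \<epsilon> / 3" using \<epsilon> by (auto simp: \<gamma>_def)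
  have L2: "0 < 1 + L\<^sup>2" by (simp add: add_pos_nonneg)
  have s: "0 < s" using \<epsilon> L2 by (auto simp: s_def add_pos_nonneg)
  have "s * L \<le> s * (1 + \<bar>L\<bar>)" using s by (intro mult_left_mono) auto
  also have "\<dots> \<le> 1 / (1 + \<bar>L\<bar>) * (1 + \<bar>L\<bar>)" by (intro mult_right_mono) (auto simp: s_def)
  also have "\<dots> = 1" by (simp add: add_nonneg_eq_0_iff)
  finally have sL: "s * L \<le> 1" .
  have "s * L\<^sup>2 \<le> s * (1 + L\<^sup>2)" using s by (intro mult_left_mono) auto
  also have "\<dots> \<le> \<epsilon> / 3 / (1 + L\<^sup>2) * (1 + L\<^sup>2)" by (intro mult_right_mono) (auto simp: s_def)
  also have "\<dots> = \<epsilon> / 3" using L2 by (intro nonzero_eq_divide_eq[THEN iffD1]) auto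
  finally have sL2: "s * L\<^sup>2 \<le> \<epsilon> / 3" .
  have e: "0 < e" using s \<epsilon> by (simp add: e_def)
  have "1 \<le> real (CARD('a \<times> 'b))"
    using zero_less_card_finite[where 'a = "'a \<times> 'b"] by linarith
  then have "0 \<le> D" using e unfolding D_def by (intro mult_nonneg_nonneg add_nonneg_nonneg divide_nonneg_pos ln_ge_zero) auto
  moreover have "(fst R + snd R) * ln 2 \<le> J + \<epsilon> + (fst Cout + snd Cout) * D"
    if "0 \<le> fst Cout" "0 \<le> snd Cout" "achievable_avg p Cin Cout R" for Cin Cout R
  proof -
    have "(fst R + snd R) * ln 2 \<le> (fst Cout + snd Cout) * D + (e / s + s * L\<^sup>2 + J - ln (1 - \<gamma>))"
      unfolding D_def by (rule achievable_rate_le[OF that J \<gamma>(1,2) e s sL L_def])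
    moreover have "e / s = \<epsilon> / 3" using s by (simp add: e_def)
    ultimately show ?thesis using sL2 \<gamma>(3) by linarith
  qed
  ultimately show ?thesis by blast
qed

text \<open>\<open>out_law\<close> is at least \<open>w * pmf (p a b) c\<close> for
  \<open>w = P a * Q b\<close>, so a summand is at most \<open>- w * ln w\<close>, which never
  exceeds 1. This crude bound serves to make the set of achievable rates bounded.\<close>

lemma mac_info_le_card:
  fixes p :: "'a::finite \<Rightarrow> 'b::finite \<Rightarrow> 'c::finite pmf"
  assumes P: "\<And>a. 0 \<le> P a" and Q: "\<And>b. 0 \<le> Q b"
  shows "mac_info p P Q \<le> CARD('a) * CARD('b)"
proof -
  have "P a * Q b * rel_ent (p a b) (out_law p P Q) \<le> 1" for a b
  proof (cases "P a * Q b = 0")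
    case False
    define w where "w = P a * Q b"
    have w: "0 < w" using False P[of a] Q[of b] by (simp add: w_def less_le)
    have "rel_ent (p a b) (out_law p P Q) \<le> (\<Sum>c\<in>UNIV. pmf (p a b) c * (- ln w))"
      unfolding rel_ent_def
    proof (rule sum_mono)
      fix c
      show "pmf (p a b) c * ln (pmf (p a b) c / out_law p P Q c) \<le> pmf (p a b) c * (- ln w)"
      proof (cases "pmf (p a b) c = 0")
        case False
        then have pos: "0 < pmf (p a b) c" by (simp add: pmf_pos)
        have le: "w * pmf (p a b) c \<le> out_law p P Q c"
          unfolding w_def by (rule out_law_ge) (use P Q in auto)
        then have out: "0 < out_law p P Q c" using w pos by (meson less_le_trans mult_pos_pos)
        have "ln (w * pmf (p a b) c) \<le> ln (out_law p P Q c)" using le out w pos by simp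
        then have "ln (pmf (p a b) c / out_law p P Q c) \<le> - ln w"
          using w pos out by (simp add: ln_mult_pos ln_divide_pos)
        then show ?thesis by (rule mult_left_mono) simp
      qed simp
    qed
    also have "\<dots> = - ln w" unfolding sum_distrib_right[symmetric] by (simp add: sum_pmf_finite)
    finally have "w * rel_ent (p a b) (out_law p P Q) \<le> w * (- ln w)"
      using w by (intro mult_left_mono) auto
    also have "w * (- ln w) \<le> w * (1 / w - 1)"
      using w ln_le_minus_one[of "1 / w"] by (intro mult_left_mono) (auto simp: ln_div)
    also have "\<dots> \<le> 1" using w by (simp add: algebra_simps)
    finally show ?thesis by (simp add: w_def)
  qed auto
  then have "mac_info p P Q \<le> (\<Sum>a\<in>(UNIV :: 'a set). \<Sum>b\<in>(UNIV :: 'b set). 1)"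
    unfolding mac_info_def by (intro sum_mono)
  then show ?thesis by simp
qed

text \<open>\<open>GREATEST\<close> says nothing unless a maximum exists. Achievable rates are
  nonnegative, so a bound on their sum bounds the set, its closure is compact, and the sum attains a
  maximum there.\<close>

lemma sum_capacity_avg_attained:
  assumes ne: "achievable_avg p Cin Cout R0"
    and bounded: "\<And>R. achievable_avg p Cin Cout R \<Longrightarrow> fst R + snd R \<le> B"
  shows "achievable_avg p Cin Cout R \<Longrightarrow> fst R + snd R \<le> sum_capacity_avg p Cin Cout"
    and "sum_capacity_avg p Cin Cout \<le> B"
proof -
  let ?A = "{R. achievable_avg p Cin Cout R}"
  have "?A \<subseteq> {0..B} \<times> {0..B}"
  proof clarify
    fix x y assume "achievable_avg p Cin Cout (x, y)"
    with bounded[OF this] show "x \<in> {0..B} \<and> y \<in> {0..B}"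
      by (auto simp: achievable_avg_def)
  qed
  then have "bounded ?A"
    by (rule bounded_subset[OF bounded_Times[OF bounded_closed_interval bounded_closed_interval]])
  then have compact: "compact (closure ?A)" by simp
  have ne': "closure ?A \<noteq> {}" using ne closure_subset[of ?A] by blast
  have cont: "continuous_on (closure ?A) (\<lambda>R. fst R + snd R)"
    by (intro continuous_intros)
  obtain R1 where R1: "R1 \<in> closure ?A"
    and max: "\<And>R. R \<in> closure ?A \<Longrightarrow> fst R + snd R \<le> fst R1 + snd R1"
    using continuous_attains_sup[OF compact ne' cont] by blast
  have eq: "sum_capacity_avg p Cin Cout = fst R1 + snd R1"
    unfolding sum_capacity_avg_def capacity_region_avg_def
    by (rule Greatest_equality) (use R1 max in \<open>auto intro!: bexI[of _ R1] simp: split_def\<close>)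
  show "fst R + snd R \<le> sum_capacity_avg p Cin Cout" if "achievable_avg p Cin Cout R"
    unfolding eq using that closure_subset[of ?A] by (intro max) auto
  have "closed {R :: real \<times> real. fst R + snd R \<le> B}"
    by (intro closed_Collect_le continuous_intros)
  then have "closure ?A \<subseteq> {R. fst R + snd R \<le> B}"
    using bounded by (intro closure_minimal) auto
  then show "sum_capacity_avg p Cin Cout \<le> B" unfolding eq using R1 by auto
qed

text \<open>A link of zero capacity can deliver only 1, so the encoders may feed 1 to the old code
  whatever a larger link delivers.\<close>

lemma achievable_avg_mono:
  assumes Cout: "0 \<le> fst Cout" "0 \<le> snd Cout" and ach: "achievable_avg p Cin (0, 0) R"
  shows "achievable_avg p Cin Cout R"
proof -
  from ach obtain c where R: "0 \<le> fst R" "0 \<le> snd R"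
    and code: "\<And>n. n \<ge> 1 \<Longrightarrow> is_cf_code Cin (0, 0) R n (c n)"
    and lim: "(\<lambda>n. avg_error_prob p R n (c n)) \<longlonglongrightarrow> 0"
    unfolding achievable_avg_def by auto
  define c' where "c' n = (c n)\<lparr>enc1 := \<lambda>w z. enc1 (c n) w 1, enc2 := \<lambda>w z. enc2 (c n) w 1\<rparr>" for n
  have one: "index_set (2 powr (real n * 0)) = {1}" for n by (auto simp: index_set_def)
  have mem: "1 \<in> index_set (2 powr (real n * fst Cout))" "1 \<in> index_set (2 powr (real n * snd Cout))" for n
    by (intro index_set_one one_le_two_powr_rate Cout)+
  have "is_cf_code Cin Cout R n (c' n)" if "n \<ge> 1" for n
    using code[OF that] mem[of n] unfolding is_cf_code_def Let_def fst_conv snd_conv one c'_def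
    by (auto simp: Pi_iff simp del: One_nat_def)
  moreover have "avg_error_prob p R n (c' n) = avg_error_prob p R n (c n)" if "n \<ge> 1" for n
  proof -
    \<comment> \<open>Claimed for actual messages only; outside the message sets the code is
      unconstrained.\<close>
    have "error_prob p n (c' n) w1 w2 = error_prob p n (c n) w1 w2"
      if w: "w1 \<in> index_set (2 powr (real n * fst R))" "w2 \<in> index_set (2 powr (real n * snd R))" for w1 w2
    proof -
      have "cf_out1 (c n) (cf_in1 (c n) w1) (cf_in2 (c n) w2) = 1" "cf_out2 (c n) (cf_in1 (c n) w1) (cf_in2 (c n) w2) = 1"
        using code[OF \<open>n \<ge> 1\<close>] w unfolding is_cf_code_def Let_def fst_conv snd_conv one
        by (auto simp: Pi_iff simp del: One_nat_def)
      then show ?thesis by (simp add: error_prob_def Let_def c'_def del: One_nat_def)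
    qed
    then show ?thesis by (simp add: avg_error_prob_def)
  qed
  then have "eventually (\<lambda>n. avg_error_prob p R n (c n) = avg_error_prob p R n (c' n)) sequentially"
    by (intro eventually_sequentiallyI[of 1]) simp
  then have "(\<lambda>n. avg_error_prob p R n (c' n)) \<longlonglongrightarrow> 0"
    using lim by (rule Lim_transform_eventually[rotated])
  ultimately show ?thesis using R unfolding achievable_avg_def by blast
qed

lemma exists_pmf_of_weights:
  fixes P :: "'a::finite \<Rightarrow> real"
  assumes "\<And>a. 0 \<le> P a" "sum P UNIV = 1"
  shows "\<exists>d. pmf d = P"
proof -
  have "(\<integral>\<^sup>+ x. ennreal (P x) \<partial>count_space UNIV) = 1"
    using assms by (simp add: nn_integral_count_space_finite sum_ennreal)
  then have "pmf (embed_pmf P) = P"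
    using assms by (intro ext pmf_embed_pmf) auto
  then show ?thesis by blast
qed

text \<open>A squeeze: opening the links cannot lower the sum capacity, and the converse, with
  \<open>J\<close> equal to \<open>ln 2\<close> times the sum capacity at zero, keeps it from rising
  by \<open>\<epsilon>\<close> close to zero.\<close>

theorem corollary4:
  fixes p :: "'a::finite \<Rightarrow> 'b::finite \<Rightarrow> 'c::finite pmf"
    and Cin :: "real \<times> real"
  assumes "0 \<le> fst Cin" and "0 \<le> snd Cin"
  shows "continuous (at (0, 0) within {0..} \<times> {0..}) (\<lambda>Cout. sum_capacity_avg p Cin Cout)"
proof -
  let ?S = "\<lambda>Cout. sum_capacity_avg p Cin Cout"
  obtain R0 where R0: "achievable_avg p Cin (0, 0) R0"
    using achievable_of_product[OF assms zero_less_one, where p = p and P = "return_pmf undefined"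
      and Q = "return_pmf undefined"] by metis
  \<comment> \<open>A first use of the converse with a crude \<open>J\<close>, because a bound on
    the rates is needed before \<open>sum_capacity_avg\<close> is known to be a maximum.\<close>
  have "\<exists>D\<ge>0. \<forall>Cin Cout R. 0 \<le> fst Cout \<longrightarrow> 0 \<le> snd Cout \<longrightarrow> achievable_avg p Cin Cout R
      \<longrightarrow> (fst R + snd R) * ln 2 \<le> real (CARD('a) * CARD('b)) + 1 + (fst Cout + snd Cout) * D"
  proof (rule converse_near_zero)
    show "mac_info p P Q \<le> real (CARD('a) * CARD('b))"
      if "\<And>a. 0 \<le> P a" "sum P UNIV = 1" "\<And>b. 0 \<le> Q b" "sum Q UNIV = 1" for P Q
      by (rule mac_info_le_card[OF that(1,3)])
  qed (rule zero_less_one)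
  then obtain D0 where D0: "\<forall>Cin Cout R. 0 \<le> fst Cout \<longrightarrow> 0 \<le> snd Cout \<longrightarrow> achievable_avg p Cin Cout R
      \<longrightarrow> (fst R + snd R) * ln 2 \<le> real (CARD('a) * CARD('b)) + 1 + (fst Cout + snd Cout) * D0" by blast
  have bound: "fst R + snd R \<le> (real (CARD('a) * CARD('b)) + 1 + (fst Cout + snd Cout) * D0) / ln 2"
    if "0 \<le> fst Cout" "0 \<le> snd Cout" "achievable_avg p Cin Cout R" for Cout R
    using D0[rule_format, OF that] by (simp add: field_simps)
  have upper: "fst R + snd R \<le> ?S Cout"
    if "0 \<le> fst Cout" "0 \<le> snd Cout" "achievable_avg p Cin Cout R" for Cout R
    by (rule sum_capacity_avg_attained(1)[OF that(3) bound[OF that(1,2)] that(3)])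
  have least: "?S Cout \<le> B"
    if "0 \<le> fst Cout" "0 \<le> snd Cout" "\<And>R. achievable_avg p Cin Cout R \<Longrightarrow> fst R + snd R \<le> B" for Cout B
    by (rule sum_capacity_avg_attained(2)[OF achievable_avg_mono[OF that(1,2) R0] that(3)])
  have mono: "?S (0, 0) \<le> ?S Cout" if C: "0 \<le> fst Cout" "0 \<le> snd Cout" for Cout
  proof (rule least)
    show "fst R + snd R \<le> ?S Cout" if "achievable_avg p Cin (0, 0) R" for R
      by (rule upper[OF C achievable_avg_mono[OF C that]])
  qed simp_all
  \<comment> \<open>Random coding reaches every product input up to \<open>\<delta>\<close> without
    help, which makes the sum capacity at zero, in nats, an admissible \<open>J\<close> for the
    second use of the converse.\<close>
  have J: "mac_info p P Q \<le> ?S (0, 0) * ln 2"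
    if PQ: "\<And>a. 0 \<le> P a" "sum P UNIV = 1" "\<And>b. 0 \<le> Q b" "sum Q UNIV = 1" for P Q
  proof (rule field_le_epsilon)
    fix \<delta> :: real assume "0 < \<delta>"
    obtain P' Q' where eq: "pmf P' = P" "pmf Q' = Q"
      using exists_pmf_of_weights[OF PQ(1,2)] exists_pmf_of_weights[OF PQ(3,4)] by blast
    from \<open>0 < \<delta>\<close> have "0 < \<delta> / 4" by simp
    then obtain R where R: "achievable_avg p Cin (0, 0) R"
      "(mac_info p (pmf P') (pmf Q') - 4 * (\<delta> / 4)) / ln 2 \<le> fst R + snd R"
      using achievable_of_product[OF assms, where p = p and P = P' and Q = Q'] by metis
    then have "(mac_info p P Q - \<delta>) / ln 2 \<le> ?S (0, 0)"
      using upper[of "(0, 0)" R] eq by simp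
    then show "mac_info p P Q \<le> ?S (0, 0) * ln 2 + \<delta>" by (simp add: field_simps)
  qed
  show ?thesis
    unfolding continuous_within Lim_within
  proof (intro allI impI)
    fix \<epsilon> :: real assume \<epsilon>: "0 < \<epsilon>"
    \<comment> \<open>Half of \<open>\<epsilon>\<close>, in nats, is for the slack of the converse
      and half for the term linear in the capacities.\<close>
    define \<eta> where "\<eta> = \<epsilon> * ln 2 / 2"
    have \<eta>: "0 < \<eta>" using \<epsilon> by (simp add: \<eta>_def)
    have "\<exists>D\<ge>0. \<forall>Cin Cout R. 0 \<le> fst Cout \<longrightarrow> 0 \<le> snd Cout \<longrightarrow> achievable_avg p Cin Cout R
        \<longrightarrow> (fst R + snd R) * ln 2 \<le> ?S (0, 0) * ln 2 + \<eta> + (fst Cout + snd Cout) * D"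
      by (rule converse_near_zero[OF _ \<eta>], rule J)
    then obtain D where D: "0 \<le> D"
      "\<forall>Cin Cout R. 0 \<le> fst Cout \<longrightarrow> 0 \<le> snd Cout \<longrightarrow> achievable_avg p Cin Cout R
        \<longrightarrow> (fst R + snd R) * ln 2 \<le> ?S (0, 0) * ln 2 + \<eta> + (fst Cout + snd Cout) * D" by blast
    \<comment> \<open>\<open>D + 1\<close> keeps the denominator positive and the later estimate
      strict; the 2 accounts for the two links.\<close>
    define d where "d = \<eta> / (2 * (D + 1))"
    have d: "0 < d" using \<eta> D by (simp add: d_def)
    have "dist (?S C) (?S (0, 0)) < \<epsilon>"
      if C: "C \<in> {0..} \<times> {0..}" "dist C (0, 0) < d" for C
    proof -
      have C0: "0 \<le> fst C" "0 \<le> snd C" using C by auto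
      have "fst C < d" "snd C < d"
        using C dist_fst_le[of C "(0, 0)"] dist_snd_le[of C "(0, 0)"] by (auto simp: dist_real_def)
      then have "(fst C + snd C) * D \<le> (d + d) * D" using D(1) by (intro mult_right_mono) auto
      also have "\<dots> < (d + d) * (D + 1)" using d by simp
      also have "\<dots> = \<eta>"
      proof -
        have "(\<eta> / (2 * k) + \<eta> / (2 * k)) * k = \<eta>" if "0 < k" for k
          using that by (simp add: field_simps)
        from this[of "D + 1"] show ?thesis using D(1) unfolding d_def by simp
      qed
      finally have small: "(fst C + snd C) * D < \<eta>" .
      have "?S C \<le> (?S (0, 0) * ln 2 + \<eta> + (fst C + snd C) * D) / ln 2"
        using D(2)[rule_format, OF C0] by (intro least C0) (simp add: field_simps)
      also have "\<dots> < (?S (0, 0) * ln 2 + \<eta> + \<eta>) / ln 2"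
        using small by (intro divide_strict_right_mono) auto
      also have "\<dots> = ?S (0, 0) + \<epsilon>" by (simp add: \<eta>_def field_simps)
      finally show ?thesis using mono[OF C0] by (simp add: dist_real_def)
    qed
    then show "\<exists>d>0. \<forall>x\<in>{0..} \<times> {0..}. 0 < dist x (0, 0) \<and> dist x (0, 0) < d \<longrightarrow> dist (?S x) (?S (0, 0)) < \<epsilon>"
      using d by blast
  qed
qed

end
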